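(* In the Kronecker quantum cluster algebra with principal coefficients $\mathcal{A}_q(Q)$, with cluster variables $x_l$ ($l\in\mathbb{Z}$), coefficients $y_1,y_2$, and elements $S_n$ (modified Chebyshev polynomials of the second kind evaluated at $X_\delta$), the following hold: (1) $x_{-(m+n+2)} x_{-m} = q^{-\frac{1}{2}} S_n X^{(0,0,m,m+1)} + x_{-(n+m+1)}x_{-(m+1)}$ for $m\geq 0$ and $n \geq 0$; (2) $x_{m+n+2} x_{m} = q^{\frac{1}{2}} S_n X^{(0,0,m,m-1)} + x_{n+m+1}x_{m+1}$ for $m\geq 1$ and $n \geq 0$; (3) $x_0x_{n+2} =q^{\frac{2n+1}{2}} x_1x_{n+1} y_2 + S_n$ for $n\geq 0$; (4) $x_{-m} x_1 =S_{m-1} + q^{\frac{1}{2}} x_{-(m-1)} x_0 y_1$ for $m\geq 1$; (5) $x_{-m} x_n =q\, x_{-(m-1)} x_{n-1} X^{(0,0,1,1)} + S_{m+n-2}$ for $m\geq 1$ and $n\geq 2$.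
   Context: Let $k=\mathbb{F}_q$ be a finite field with $q$ elements. Let $\Lambda$ be the skew-symmetric bilinear form on $\mathbb{Z}^4$ (natural basis $e_1,\dots,e_4$) with $\Lambda(e_1,e_3)=-1$, $\Lambda(e_2,e_4)=-1$, $\Lambda(e_3,e_4)=-2$, $\Lambda(e_1,e_2)=\Lambda(e_1,e_4)=\Lambda(e_2,e_3)=0$. The quantum torus is the $\mathbb{Z}[q^{\pm 1/2}]$-algebra with basis $\{X^{e}: e\in\mathbb{Z}^4\}$ and product $X^{e}X^{f}=q^{\Lambda(e,f)/2}X^{e+f}$. All identities are in this algebra. Put $y_1=X^{(0,0,1,0)}$, $y_2=X^{(0,0,0,1)}$ (the coefficients). Let $Q$ be the Kronecker quiver with two vertices $1,2$ and two arrows $1\to 2$. For $l\ge 0$ let $V(-l)$ be the indecomposable preprojective $kQ$-module with dimension vector $(l,l+1)$ and $V(l+3)$ the indecomposable preinjective $kQ$-module with dimension vector $(l+1,l)$. For a $kQ$-module $M$ with dimension vector $m=(m_1,m_2)$, the quantum cluster character is $$X_M=\sum_{e=(e_1,e_2)}|\mathrm{Gr}_e M|\,q^{-\frac12\langle e,m-e\rangle}X^{(2m_2-m_1-2e_2,\;2e_1-m_2,\;m_1-e_1,\;m_2-e_2)},$$ where $\mathrm{Gr}_eM$ is the set of submodules of $M$ of dimension vector $e$ and $\langle a,b\rangle=a_1b_1+a_2b_2-2a_1b_2$ is the Euler form. The cluster variables are $x_1=X^{(1,0,0,0)}$, $x_2=X^{(0,1,0,0)}$ and $x_l=X_{V(l)}$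 for $l\in\mathbb{Z}\setminus\{1,2\}$. The algebra $\mathcal{A}_q(Q)$ is the subalgebra of the quantum torus generated over $\mathbb{Z}[q^{\pm1/2}][y_1^{\pm1},y_2^{\pm1}]$ by all $x_l$, $l\in\mathbb{Z}$. Let $X_\delta=X^{(1,-1,1,1)}+X^{(-1,-1,1,0)}+X^{(-1,1,0,0)}$. Define $S_0=1$, $S_1=X_\delta$, $S_2=S_1S_1-X^{(0,0,1,1)}$, and $S_{n+1}=S_nS_1-X^{(0,0,1,1)}S_{n-1}$ for $n\ge 2$. *)

theory Defs
  imports Jordan_Normal_Form.VS_Connect "HOL-Library.Product_Plus"
begin

inductive_set subring_gen :: "'a::ring_1 set \<Rightarrow> 'a set" for S :: "'a set" where
  gen: "a \<in> S \<Longrightarrow> a \<in> subring_gen S"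
| one: "1 \<in> subring_gen S"
| diff: "a \<in> subring_gen S \<Longrightarrow> b \<in> subring_gen S \<Longrightarrow> a - b \<in> subring_gen S"
| mult: "a \<in> subring_gen S \<Longrightarrow> b \<in> subring_gen S \<Longrightarrow> a * b \<in> subring_gen S"

lemma subring_gen_zero: "0 \<in> subring_gen S"
  using subring_gen.diff[OF subring_gen.one subring_gen.one] by simp

lemma subring_gen_uminus: "a \<in> subring_gen S \<Longrightarrow> - a \<in> subring_gen S"
  using subring_gen.diff[OF subring_gen_zero] by force

lemma subring_gen_add:
  assumes "a \<in> subring_gen S" "b \<in> subring_gen S"
  shows "a + b \<in> subring_gen S"
  using subring_gen.diff[OF assms(1) subring_gen_uminus[OF assms(2)]] by simp

lemma subring_gen_sum:
  "(\<And>i. i \<in> I \<Longrightarrow> f i \<in> subring_gen S) \<Longrightarrow> (\<Sum>i\<in>I. f i) \<in> subring_gen S"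
  by (induction I rule: infinite_finite_induct) (auto intro: subring_gen_zero subring_gen_add)

lemma subring_gen_power: "a \<in> subring_gen S \<Longrightarrow> a ^ n \<in> subring_gen S"
  by (induction n) (auto intro: subring_gen.intros)


section \<open>The quantum torus\<close>

type_synonym lat = "int \<times> int \<times> int \<times> int"

fun Lam :: "lat \<Rightarrow> lat \<Rightarrow> int" where
  "Lam (a1, a2, a3, a4) (b1, b2, b3, b4) =
     - (a1 * b3 - a3 * b1) - (a2 * b4 - a4 * b2) - 2 * (a3 * b4 - a4 * b3)"

lemma Lam_add_left: "Lam (a + b) c = Lam a c + Lam b c"
  by (cases a; cases b; cases c) (simp add: algebra_simps)

lemma Lam_add_right: "Lam a (b + c) = Lam a b + Lam a c"
  by (cases a; cases b; cases c) (simp add: algebra_simps)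

lemma Lam_zero [simp]: "Lam 0 c = 0" "Lam c 0 = 0"
  by (cases c; simp add: zero_prod_def)+

text \<open>The positive real number \<open>q\<^sup>1\<^sup>/\<^sup>2\<close>, where \<open>q\<close> is the cardinality of the ground field, and the
  subring \<open>\<int>[q\<^sup>1\<^sup>/\<^sup>2, q\<^sup>-\<^sup>1\<^sup>/\<^sup>2]\<close> of the reals.\<close>

definition sqrt_q :: "'k::finite itself \<Rightarrow> real" where
  "sqrt_q _ = sqrt (real (card (UNIV :: 'k set)))"

definition Zq :: "'k::finite itself \<Rightarrow> real set" where
  "Zq T = subring_gen {sqrt_q T, inverse (sqrt_q T)}"

lemma sqrt_q_pos: "sqrt_q T > 0"
  by (simp add: sqrt_q_def card_gt_0_iff)

lemma Zq_powi: "sqrt_q T powi i \<in> Zq T"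
  unfolding Zq_def power_int_def
  by (cases "i \<ge> 0") (auto simp del: power_inverse intro!: subring_gen_power intro: subring_gen.gen)

lemma Zq_intros:
  "0 \<in> Zq T" "1 \<in> Zq T"
  "a \<in> Zq T \<Longrightarrow> b \<in> Zq T \<Longrightarrow> a - b \<in> Zq T"
  "a \<in> Zq T \<Longrightarrow> b \<in> Zq T \<Longrightarrow> a * b \<in> Zq T"
  "a \<in> Zq T \<Longrightarrow> b \<in> Zq T \<Longrightarrow> a + b \<in> Zq T"
  "a \<in> Zq T \<Longrightarrow> - a \<in> Zq T"
  "sqrt_q T powi i \<in> Zq T"
  by (rule Zq_powi | simp add: Zq_def subring_gen_zero subring_gen_uminus
      subring_gen_add subring_gen.intros)+

lemma Zq_sum: "(\<And>i. i \<in> I \<Longrightarrow> f i \<in> Zq T) \<Longrightarrow> (\<Sum>i\<in>I. f i) \<in> Zq T"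
  unfolding Zq_def by (rule subring_gen_sum)

text \<open>Elements of the quantum torus are the families of coefficients with respect to the basis
  \<open>X\<^sup>e\<close>. The type parameter is the ground field, which enters only through its cardinality.\<close>

typedef ('k::finite) qtorus =
  "{f :: lat \<Rightarrow> real. finite {e. f e \<noteq> 0} \<and> (\<forall>e. f e \<in> Zq TYPE('k))}"
  morphisms coef Abs_qtorus
  by (rule exI[of _ "\<lambda>_. 0"]) (auto intro: Zq_intros)

setup_lifting type_definition_qtorus

lemma finite_supp: "finite {e. coef f e \<noteq> 0}"
  using coef[of f] by simp

definition conv :: "real \<Rightarrow> (lat \<Rightarrow> real) \<Rightarrow> (lat \<Rightarrow> real) \<Rightarrow> lat \<Rightarrow> real" where
  "conv s f g c = (\<Sum>a | f a \<noteq> 0. s powi Lam a (c - a) * f a * g (c - a))"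

lemma conv_superset:
  assumes "finite F" "{a. f a \<noteq> 0} \<subseteq> F"
  shows "conv s f g c = (\<Sum>a\<in>F. s powi Lam a (c - a) * f a * g (c - a))"
  unfolding conv_def by (rule sum.mono_neutral_left) (use assms in auto)

lemma conv_supp:
  "{c. conv s f g c \<noteq> 0} \<subseteq> (\<lambda>(a, b). a + b) ` ({a. f a \<noteq> 0} \<times> {b. g b \<noteq> 0})"
proof
  fix c assume c: "c \<in> {c. conv s f g c \<noteq> 0}"
  have "\<exists>a. f a \<noteq> 0 \<and> g (c - a) \<noteq> 0"
  proof (rule ccontr)
    assume "\<not> ?thesis"
    then have "conv s f g c = 0"
      unfolding conv_def by (intro sum.neutral) auto
    then show False using c by simp
  qed
  then obtain a where "f a \<noteq> 0" "g (c - a) \<noteq> 0" by blast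
  moreover have "c = a + (c - a)" by simp
  ultimately show "c \<in> (\<lambda>(a, b). a + b) ` ({a. f a \<noteq> 0} \<times> {b. g b \<noteq> 0})"
    by (auto intro!: image_eqI[of _ _ "(a, c - a)"])
qed

lemma conv_finite:
  "finite {a. f a \<noteq> 0} \<Longrightarrow> finite {b. g b \<noteq> 0} \<Longrightarrow> finite {c. conv s f g c \<noteq> 0}"
  by (rule finite_subset[OF conv_supp]) auto

lemma conv_assoc:
  assumes s: "s \<noteq> 0" and f: "finite {a. f a \<noteq> 0}" and g: "finite {a. g a \<noteq> 0}"
  shows "conv s (conv s f g) h c = conv s f (conv s g h) c"
proof -
  define F where "F = {a. f a \<noteq> 0}"
  define G where "G = {a. g a \<noteq> 0}"
  define D where "D = (\<lambda>(a, b). a + b) ` (F \<times> G)"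
  have fin: "finite F" "finite G" "finite D"
    using f g by (auto simp: F_def G_def D_def)
  have "conv s (conv s f g) h c = (\<Sum>d\<in>D. s powi Lam d (c - d) * conv s f g d * h (c - d))"
    by (rule conv_superset) (use fin conv_supp[of s f g] in \<open>auto simp: D_def F_def G_def\<close>)
  also have "\<dots> = (\<Sum>d\<in>D. \<Sum>a\<in>F. s powi Lam d (c - d) * (s powi Lam a (d - a) * f a * g (d - a)) * h (c - d))"
    by (simp add: conv_def F_def sum_distrib_left sum_distrib_right)
  also have "\<dots> = (\<Sum>a\<in>F. \<Sum>d\<in>D. s powi Lam d (c - d) * (s powi Lam a (d - a) * f a * g (d - a)) * h (c - d))"
    by (rule sum.swap)
  also have "\<dots> = (\<Sum>a\<in>F. \<Sum>b\<in>G. s powi Lam (a + b) (c - a - b) * (s powi Lam a b * f a * g b) * h (c - a - b))"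
  proof (rule sum.cong[OF refl])
    fix a assume a: "a \<in> F"
    have "(\<Sum>d\<in>D. s powi Lam d (c - d) * (s powi Lam a (d - a) * f a * g (d - a)) * h (c - d)) =
      (\<Sum>d\<in>(+) a ` G. s powi Lam d (c - d) * (s powi Lam a (d - a) * f a * g (d - a)) * h (c - d))"
    proof (rule sum.mono_neutral_right[OF fin(3)])
      show "(+) a ` G \<subseteq> D" using a by (auto simp: D_def)
      show "\<forall>d\<in>D - (+) a ` G.
        s powi Lam d (c - d) * (s powi Lam a (d - a) * f a * g (d - a)) * h (c - d) = 0"
      proof
        fix d assume "d \<in> D - (+) a ` G"
        then have "d - a \<notin> G" by (metis DiffD2 add.commute diff_add_cancel image_eqI)
        then show "s powi Lam d (c - d) * (s powi Lam a (d - a) * f a * g (d - a)) * h (c - d) = 0"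
          by (simp add: G_def)
      qed
    qed
    also have "\<dots> = (\<Sum>b\<in>G. s powi Lam (a + b) (c - a - b) * (s powi Lam a b * f a * g b) * h (c - a - b))"
      by (subst sum.reindex) (auto simp: inj_on_def diff_diff_eq)
    finally show "(\<Sum>d\<in>D. s powi Lam d (c - d) * (s powi Lam a (d - a) * f a * g (d - a)) * h (c - d)) =
      (\<Sum>b\<in>G. s powi Lam (a + b) (c - a - b) * (s powi Lam a b * f a * g b) * h (c - a - b))" .
  qed
  also have "\<dots> = (\<Sum>a\<in>F. \<Sum>b\<in>G. s powi Lam a (c - a) * f a * (s powi Lam b (c - a - b) * g b * h (c - a - b)))"
  proof (intro sum.cong refl)
    fix a b
    have "Lam (a + b) (c - a - b) + Lam a b = Lam a (c - a) + Lam b (c - a - b)"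
      using Lam_add_right[of a b "c - a - b"] by (simp add: Lam_add_left)
    then have "s powi Lam (a + b) (c - a - b) * s powi Lam a b
        = s powi Lam a (c - a) * s powi Lam b (c - a - b)"
      using s by (simp flip: power_int_add)
    then show "s powi Lam (a + b) (c - a - b) * (s powi Lam a b * f a * g b) * h (c - a - b)
        = s powi Lam a (c - a) * f a * (s powi Lam b (c - a - b) * g b * h (c - a - b))"
      by (simp add: mult_ac)
  qed
  also have "\<dots> = conv s f (conv s g h) c"
    by (simp add: conv_def F_def G_def sum_distrib_left)
  finally show ?thesis .
qed

instantiation qtorus :: (finite) ring_1
begin

lift_definition zero_qtorus :: "'a qtorus" is "\<lambda>_. 0"
  by (auto intro: Zq_intros)

lift_definition one_qtorus :: "'a qtorus" is "\<lambda>e. if e = 0 then 1 else 0"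
  by (auto intro: Zq_intros)

lift_definition plus_qtorus :: "'a qtorus \<Rightarrow> 'a qtorus \<Rightarrow> 'a qtorus" is "\<lambda>f g e. f e + g e"
proof -
  fix f g :: "lat \<Rightarrow> real"
  assume a: "finite {e. f e \<noteq> 0} \<and> (\<forall>e. f e \<in> Zq TYPE('a))"
    "finite {e. g e \<noteq> 0} \<and> (\<forall>e. g e \<in> Zq TYPE('a))"
  have "finite {e. f e + g e \<noteq> 0}"
    by (rule finite_subset[of _ "{e. f e \<noteq> 0} \<union> {e. g e \<noteq> 0}"]) (use a in auto)
  then show "finite {e. f e + g e \<noteq> 0} \<and> (\<forall>e. f e + g e \<in> Zq TYPE('a))"
    using a by (auto intro: Zq_intros)
qed

lift_definition uminus_qtorus :: "'a qtorus \<Rightarrow> 'a qtorus" is "\<lambda>f e. - f e"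
  by (auto intro: Zq_intros)

lift_definition minus_qtorus :: "'a qtorus \<Rightarrow> 'a qtorus \<Rightarrow> 'a qtorus" is "\<lambda>f g e. f e - g e"
proof -
  fix f g :: "lat \<Rightarrow> real"
  assume a: "finite {e. f e \<noteq> 0} \<and> (\<forall>e. f e \<in> Zq TYPE('a))"
    "finite {e. g e \<noteq> 0} \<and> (\<forall>e. g e \<in> Zq TYPE('a))"
  have "finite {e. f e - g e \<noteq> 0}"
    by (rule finite_subset[of _ "{e. f e \<noteq> 0} \<union> {e. g e \<noteq> 0}"]) (use a in auto)
  then show "finite {e. f e - g e \<noteq> 0} \<and> (\<forall>e. f e - g e \<in> Zq TYPE('a))"
    using a by (auto intro: Zq_intros)
qed

lift_definition times_qtorus :: "'a qtorus \<Rightarrow> 'a qtorus \<Rightarrow> 'a qtorus"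
  is "conv (sqrt_q TYPE('a))"
  by (intro conjI allI conv_finite) (auto simp: conv_def intro!: Zq_sum Zq_intros)

instance
proof
  fix a b c :: "'a qtorus"
  show "a + b + c = a + (b + c)" "a + b = b + a" "0 + a = a" "- a + a = 0" "a - b = a + - b"
    by (transfer; force simp: add_ac)+
  show "a * b * c = a * (b * c)"
    by transfer (use sqrt_q_pos[where 'a = 'a] in \<open>auto simp: fun_eq_iff intro!: conv_assoc simp: less_le\<close>)
  show "1 * a = a"
    by transfer (simp add: fun_eq_iff conv_superset[of "{0}"])
  show "a * 1 = a"
  proof transfer
    fix f :: "lat \<Rightarrow> real"
    assume f: "finite {e. f e \<noteq> 0} \<and> (\<forall>e. f e \<in> Zq TYPE('a))"
    show "conv (sqrt_q TYPE('a)) f (\<lambda>e. if e = 0 then 1 else 0) = f"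
    proof
      fix c
      have "conv (sqrt_q TYPE('a)) f (\<lambda>e. if e = 0 then 1 else 0) c =
        (\<Sum>a\<in>insert c {e. f e \<noteq> 0}. sqrt_q TYPE('a) powi Lam a (c - a) * f a * (if c - a = 0 then 1 else 0))"
        by (rule conv_superset) (use f in auto)
      also have "\<dots> = (\<Sum>a\<in>insert c {e. f e \<noteq> 0}. if a = c then f c else 0)"
        by (rule sum.cong) auto
      also have "\<dots> = f c" using f by simp
      finally show "conv (sqrt_q TYPE('a)) f (\<lambda>e. if e = 0 then 1 else 0) c = f c" .
    qed
  qed
  show "(a + b) * c = a * c + b * c"
  proof transfer
    fix f g h :: "lat \<Rightarrow> real"
    assume a: "finite {e. f e \<noteq> 0} \<and> (\<forall>e. f e \<in> Zq TYPE('a))"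
      "finite {e. g e \<noteq> 0} \<and> (\<forall>e. g e \<in> Zq TYPE('a))"
    let ?F = "{e. f e \<noteq> 0} \<union> {e. g e \<noteq> 0}"
    have "finite ?F" using a by simp
    then have "conv s f h c = (\<Sum>a\<in>?F. s powi Lam a (c - a) * f a * h (c - a))"
      "conv s g h c = (\<Sum>a\<in>?F. s powi Lam a (c - a) * g a * h (c - a))"
      "conv s (\<lambda>e. f e + g e) h c = (\<Sum>a\<in>?F. s powi Lam a (c - a) * (f a + g a) * h (c - a))"
      for s c by (auto intro!: conv_superset)
    then show "conv (sqrt_q TYPE('a)) (\<lambda>e. f e + g e) h =
        (\<lambda>e. conv (sqrt_q TYPE('a)) f h e + conv (sqrt_q TYPE('a)) g h e)"
      by (auto simp: algebra_simps sum.distrib)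
  qed
  show "a * (b + c) = a * b + a * c"
    by transfer (simp add: conv_def fun_eq_iff algebra_simps sum.distrib)
  show "(0::'a qtorus) \<noteq> 1"
    by transfer (auto dest: fun_cong[of _ _ 0])
qed

end

lift_definition X :: "lat \<Rightarrow> 'k::finite qtorus" is "\<lambda>e c. if c = e then 1 else 0"
  by (auto intro: Zq_intros)

text \<open>The scalar \<open>q\<^sup>i\<^sup>/\<^sup>2\<close> (note the half) as an element of the quantum torus.\<close>

lift_definition qh :: "int \<Rightarrow> 'k::finite qtorus"
  is "\<lambda>i c. if c = 0 then sqrt_q TYPE('k) powi i else 0"
  by (auto intro: Zq_intros)

lemma X_mult: "X e * X f = (qh (Lam e f) * X (e + f) :: 'k::finite qtorus)"
proof transfer
  fix e f :: lat
  let ?s = "sqrt_q TYPE('k)"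
  have "conv ?s (\<lambda>c. if c = e then 1 else 0) (\<lambda>c. if c = f then 1 else 0) c =
      conv ?s (\<lambda>c. if c = 0 then ?s powi Lam e f else 0) (\<lambda>c. if c = e + f then 1 else 0) c" for c
    by (subst conv_superset[of "{e}"], simp, simp, subst conv_superset[of "{0}"])
       (auto simp: algebra_simps)
  then show "conv ?s (\<lambda>c. if c = e then 1 else 0) (\<lambda>c. if c = f then 1 else 0) =
      conv ?s (\<lambda>c. if c = 0 then ?s powi Lam e f else 0) (\<lambda>c. if c = e + f then 1 else 0)"
    by blast
qed


section \<open>Modules over the Kronecker algebra\<close>

text \<open>A finite-dimensional \<open>kQ\<close>-module is given, up to isomorphism, by the spaces \<open>k\<^sup>m\<^sup>1\<close>, \<open>k\<^sup>m\<^sup>2\<close> at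
  the vertices \<open>1\<close>, \<open>2\<close> and by the two \<open>m\<^sub>2 \<times> m\<^sub>1\<close> matrices of the arrows \<open>1 \<rightarrow> 2\<close>.\<close>

type_synonym 'k kmod = "'k mat \<times> 'k mat"

definition is_kmod :: "'k kmod \<Rightarrow> bool" where
  "is_kmod M \<longleftrightarrow> dim_row (fst M) = dim_row (snd M) \<and> dim_col (fst M) = dim_col (snd M)"

definition dim1 :: "'k kmod \<Rightarrow> nat" where "dim1 M = dim_col (fst M)"
definition dim2 :: "'k kmod \<Rightarrow> nat" where "dim2 M = dim_row (fst M)"

definition dimvec :: "'k kmod \<Rightarrow> nat \<times> nat" where
  "dimvec M = (dim1 M, dim2 M)"

definition submodules :: "'k::field kmod \<Rightarrow> ('k vec set \<times> 'k vec set) set" where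
  "submodules M = {(U1, U2).
     subspace class_ring U1 (module_vec TYPE('k) (dim1 M)) \<and>
     subspace class_ring U2 (module_vec TYPE('k) (dim2 M)) \<and>
     (\<forall>u\<in>U1. fst M *\<^sub>v u \<in> U2 \<and> snd M *\<^sub>v u \<in> U2)}"

definition subspace_dim :: "nat \<Rightarrow> 'k::field vec set \<Rightarrow> nat" where
  "subspace_dim n U = vectorspace.dim class_ring ((module_vec TYPE('k) n)\<lparr>carrier := U\<rparr>)"

definition Gr :: "nat \<times> nat \<Rightarrow> 'k::field kmod \<Rightarrow> ('k vec set \<times> 'k vec set) set" where
  "Gr e M = {(U1, U2) \<in> submodules M.
     subspace_dim (dim1 M) U1 = fst e \<and> subspace_dim (dim2 M) U2 = snd e}"

definition complementary :: "nat \<Rightarrow> 'k::field vec set \<Rightarrow> 'k vec set \<Rightarrow> bool" where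
  "complementary n U W \<longleftrightarrow> U \<inter> W = {0\<^sub>v n} \<and> {u + w | u w. u \<in> U \<and> w \<in> W} = carrier_vec n"

definition indecomposable :: "'k::field kmod \<Rightarrow> bool" where
  "indecomposable M \<longleftrightarrow> is_kmod M \<and> dimvec M \<noteq> (0, 0) \<and>
     (\<forall>U1 U2 W1 W2. (U1, U2) \<in> submodules M \<longrightarrow> (W1, W2) \<in> submodules M \<longrightarrow>
        complementary (dim1 M) U1 W1 \<longrightarrow> complementary (dim2 M) U2 W2 \<longrightarrow>
        (U1, U2) = ({0\<^sub>v (dim1 M)}, {0\<^sub>v (dim2 M)}) \<or>
        (W1, W2) = ({0\<^sub>v (dim1 M)}, {0\<^sub>v (dim2 M)}))"

text \<open>Bernstein-Gelfand-Ponomarev reflections. Reflecting the Kronecker quiver at one vertex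
  reverses both arrows; interchanging the names of the vertices yields the Kronecker quiver again.
  So, if \<open>M = (A, B : M\<^sub>1 \<rightarrow> M\<^sub>2)\<close>, the reflection of \<open>M\<close> at the sink \<open>2\<close> is the module
  \<open>ker (M\<^sub>1 \<oplus> M\<^sub>1 \<rightarrow> M\<^sub>2) \<rightarrow> M\<^sub>1\<close> given by the two projections, and its reflection at the source \<open>1\<close>
  is the module \<open>M\<^sub>2 \<rightarrow> coker (M\<^sub>1 \<rightarrow> M\<^sub>2 \<oplus> M\<^sub>2)\<close> given by the two inclusions. Both are described up to
  isomorphism, and two successive reflections make up a Coxeter functor (the Auslander-Reiten
  translation, up to a sign change of arrows).\<close>

definition sink_reflection :: "'k::field kmod \<Rightarrow> 'k kmod \<Rightarrow> bool" where
  "sink_reflection M N \<longleftrightarrow> is_kmod M \<and> is_kmod N \<and> dim2 N = dim1 M \<and>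
     bij_betw (\<lambda>x. (fst N *\<^sub>v x, snd N *\<^sub>v x)) (carrier_vec (dim1 N))
       {(u, v) \<in> carrier_vec (dim1 M) \<times> carrier_vec (dim1 M).
          fst M *\<^sub>v u + snd M *\<^sub>v v = 0\<^sub>v (dim2 M)}"

definition source_reflection :: "'k::field kmod \<Rightarrow> 'k kmod \<Rightarrow> bool" where
  "source_reflection M N \<longleftrightarrow> is_kmod M \<and> is_kmod N \<and> dim1 N = dim2 M \<and>
     (\<lambda>(u, v). fst N *\<^sub>v u + snd N *\<^sub>v v) ` (carrier_vec (dim2 M) \<times> carrier_vec (dim2 M))
       = carrier_vec (dim2 N) \<and>
     {(u, v) \<in> carrier_vec (dim2 M) \<times> carrier_vec (dim2 M).
        fst N *\<^sub>v u + snd N *\<^sub>v v = 0\<^sub>v (dim2 N)}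
       = (\<lambda>x. (fst M *\<^sub>v x, snd M *\<^sub>v x)) ` carrier_vec (dim1 M)"

text \<open>A module is preprojective (preinjective) if it is annihilated by some power of the Coxeter
  functor \<open>C\<^sup>+\<close> (\<open>C\<^sup>-\<close>), or equivalently by an iterated reflection, as reflections map \<open>0\<close> to \<open>0\<close>.\<close>

inductive preprojective :: "'k::field kmod \<Rightarrow> bool" where
  "is_kmod M \<Longrightarrow> dimvec M = (0, 0) \<Longrightarrow> preprojective M"
| "sink_reflection M N \<Longrightarrow> preprojective N \<Longrightarrow> preprojective M"

inductive preinjective :: "'k::field kmod \<Rightarrow> bool" where
  "is_kmod M \<Longrightarrow> dimvec M = (0, 0) \<Longrightarrow> preinjective M"
| "source_reflection M N \<Longrightarrow> preinjective N \<Longrightarrow> preinjective M"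


section \<open>The quantum cluster algebra\<close>

fun euler :: "int \<times> int \<Rightarrow> int \<times> int \<Rightarrow> int" where
  "euler (a1, a2) (b1, b2) = a1 * b1 + a2 * b2 - 2 * a1 * b2"

definition XM :: "'k::{field,finite} kmod \<Rightarrow> 'k qtorus" where
  "XM M = (let m1 = int (dim1 M); m2 = int (dim2 M) in
     \<Sum>(e1, e2) \<in> {0..dim1 M} \<times> {0..dim2 M}.
       of_nat (card (Gr (e1, e2) M)) *
       qh (- euler (int e1, int e2) (m1 - int e1, m2 - int e2)) *
       X (2 * m2 - m1 - 2 * int e2, 2 * int e1 - m2, m1 - int e1, m2 - int e2))"

abbreviation y1 :: "'k::finite qtorus" where "y1 \<equiv> X (0, 0, 1, 0)"
abbreviation y2 :: "'k::finite qtorus" where "y2 \<equiv> X (0, 0, 0, 1)"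

definition cvar :: "(int \<Rightarrow> 'k::{field,finite} kmod) \<Rightarrow> int \<Rightarrow> 'k qtorus" where
  "cvar V l = (if l = 1 then X (1, 0, 0, 0) else if l = 2 then X (0, 1, 0, 0) else XM (V l))"

definition Aq :: "(int \<Rightarrow> 'k::{field,finite} kmod) \<Rightarrow> 'k qtorus set" where
  "Aq V = subring_gen
     ({qh 1, qh (-1), y1, X (0, 0, -1, 0), y2, X (0, 0, 0, -1)} \<union> range (cvar V))"

definition Xdelta :: "'k::finite qtorus" where
  "Xdelta = X (1, -1, 1, 1) + X (-1, -1, 1, 0) + X (-1, 1, 0, 0)"

fun S :: "nat \<Rightarrow> 'k::finite qtorus" where
  "S 0 = 1"
| "S (Suc 0) = Xdelta"
| "S (Suc (Suc n)) = S (Suc n) * S (Suc 0) - X (0, 0, 1, 1) * S n"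

end

theory Submission
  imports Defs "HOL-Library.Cardinality"
begin

text \<open>All five identities rest on one linear recurrence. Put \<open>D = Xdelta\<close> and \<open>Y = X (0, 0, 1, 1)\<close>. Each of
  the two rays of cluster variables, \<open>x\<^sub>0, x\<^sub>-\<^sub>1, x\<^sub>-\<^sub>2, \<dots>\<close> (prolonged by two monomials in front of \<open>x\<^sub>0\<close>) and
  \<open>x\<^sub>1, x\<^sub>2, x\<^sub>3, \<dots>\<close>, is a solution \<open>t\<close> of \<open>t (k + 2) = D * t (k + 1) - Y * t k\<close>, and also of the mirrored
  recurrence with \<open>D\<close> and \<open>Y\<close> on the right. The elements \<open>S n\<close> satisfy it too and commute with \<open>D\<close> and \<open>Y\<close>;
  hence a solution \<open>w\<close> with \<open>w 0 = 0\<close> is \<open>w (n + 1) = S n * w 1\<close> (lemma \<open>S_unique\<close>). In each identity the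
  difference of the two products, regarded as a function of a suitable index, is such a solution, and
  its first values are found by multiplying monomials. In the first two identities the value
  \<open>w 1 = t (k + 2) * t k - t (k + 1) * t (k + 1)\<close> is the exchange relation, which follows from its
  case \<open>k = 0\<close> by the recurrence again (locale \<open>cluster_ray\<close>).

  To prove the recurrence for the characters \<open>XM\<close>, compare coefficients: it becomes an identity with
  five terms between cardinalities of quiver Grassmannians (lemma \<open>has_expansion_recurrence\<close>). These
  are products of two Gaussian binomials, and the identity is a combination of two Pascal identities.

  The cardinalities are found by induction along reflections. Let \<open>N\<close> be the sink reflection of \<open>M\<close>. A
  subspace \<open>U\<close> of \<open>M\<^sub>1 = N\<^sub>2\<close> is completed to a submodule of \<open>M\<close> by a subspace above the span of its images
  under the arrows, and to a submodule of \<open>N\<close> by a subspace of its common preimage; the dimensions of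
  these two spaces add up to \<open>2 * dim U\<close>. So the quiver Grassmannians of \<open>M\<close> and those of \<open>N\<close> are governed by
  the same distribution of dimensions. Gaussian binomials span all functions, so this distribution can
  be recovered from either module (lemma \<open>gauss_binom_moments_determine\<close>), and the
  \<open>q\<close>-Vandermonde identity evaluates the sums that arise.\<close>

section \<open>Gaussian binomial coefficients\<close>

definition q_factorial :: "real \<Rightarrow> nat \<Rightarrow> real" where
  "q_factorial q n = (\<Prod>i<n. q ^ Suc i - 1)"

text \<open>The quotient of factorials, rather than a polynomial in \<open>q\<close>: the base is always the order of a
  field, so the denominators do not vanish.\<close>

definition gauss_binom :: "real \<Rightarrow> nat \<Rightarrow> nat \<Rightarrow> real" where
  "gauss_binom q n k = (if k \<le> n then q_factorial q n / (q_factorial q k * q_factorial q (n - k)) else 0)"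

lemma q_factorial_0 [simp]: "q_factorial q 0 = 1"
  by (simp add: q_factorial_def)

lemma q_factorial_Suc: "q_factorial q (Suc n) = (q ^ Suc n - 1) * q_factorial q n"
  by (simp add: q_factorial_def)

context
  fixes q :: real
  assumes q: "q > 1"
begin

lemma power_Suc_gt_1: "q ^ Suc n - 1 > 0"
  using one_less_power[OF q, of "Suc n"] by simp

lemma q_factorial_nonzero [simp]: "q_factorial q n \<noteq> 0"
proof (induction n)
  case (Suc n)
  then show ?case using power_Suc_gt_1[of n] by (simp add: q_factorial_Suc del: power_Suc)
qed simp

lemma gauss_binom_0 [simp]: "gauss_binom q n 0 = 1"
  by (simp add: gauss_binom_def)

lemma gauss_binom_diag [simp]: "gauss_binom q n n = 1"
  by (simp add: gauss_binom_def)

lemma gauss_binom_eq_0 [simp]: "n < k \<Longrightarrow> gauss_binom q n k = 0"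
  by (simp add: gauss_binom_def)

lemma gauss_binom_symmetric: "k \<le> n \<Longrightarrow> gauss_binom q n (n - k) = gauss_binom q n k"
  by (simp add: gauss_binom_def mult.commute)

lemma gauss_binom_absorption: "(q ^ Suc k - 1) * gauss_binom q (Suc n) (Suc k) = (q ^ Suc n - 1) * gauss_binom q n k"
  using power_Suc_gt_1[of k] by (simp add: gauss_binom_def q_factorial_Suc del: power_Suc)

lemma gauss_binom_Pascal:
  assumes "k \<le> n"
  shows "gauss_binom q (Suc n) (Suc k) = gauss_binom q n (Suc k) + q ^ (n - k) * gauss_binom q n k"
proof (cases "k = n")
  case True
  then show ?thesis by simp
next
  case False
  define m where "m = n - Suc k"
  have n: "n = Suc (k + m)" using False assms by (simp add: m_def)
  define x y A B F where "x = q ^ Suc k" and "y = q ^ Suc m"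
    and "A = q_factorial q k" and "B = q_factorial q m" and "F = q_factorial q n"
  have nz: "x - 1 \<noteq> 0" "y - 1 \<noteq> 0" "A \<noteq> 0" "B \<noteq> 0"
    using power_Suc_gt_1[of k] power_Suc_gt_1[of m] by (simp_all add: x_def y_def A_def B_def)
  have xy: "q ^ Suc n = x * y"
    by (simp add: n x_def y_def power_add)
  have "gauss_binom q (Suc n) (Suc k) = (x * y - 1) * F / ((x - 1) * A * ((y - 1) * B))"
    unfolding gauss_binom_def F_def x_def y_def A_def B_def
    by (simp add: n q_factorial_Suc power_add)
  moreover have "gauss_binom q n (Suc k) = F / ((x - 1) * A * B)"
    unfolding gauss_binom_def F_def x_def A_def B_def by (simp add: n q_factorial_Suc del: power_Suc)
  moreover have "gauss_binom q n k = F / (A * ((y - 1) * B))"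
    unfolding gauss_binom_def F_def y_def A_def B_def by (simp add: n q_factorial_Suc Suc_diff_le del: power_Suc)
  moreover have "q ^ (n - k) = y"
    by (simp add: n y_def Suc_diff_le)
  moreover have "(x * y - 1) * F / ((x - 1) * A * ((y - 1) * B)) =
      F / ((x - 1) * A * B) + y * (F / (A * ((y - 1) * B)))"
    using nz by (simp add: divide_simps) (simp add: algebra_simps)
  ultimately show ?thesis by simp
qed

lemma gauss_binom_trinomial:
  assumes "j \<le> k" "k \<le> n"
  shows "gauss_binom q n k * gauss_binom q k j = gauss_binom q n j * gauss_binom q (n - j) (k - j)"
  using assms by (simp add: gauss_binom_def)

lemma gauss_binom_mult_swap: "gauss_binom q n j * gauss_binom q (n - j) c = gauss_binom q n c * gauss_binom q (n - c) j"
  by (cases "j + c \<le> n") (auto simp: gauss_binom_def add.commute)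

text \<open>The \<open>q\<close>-Vandermonde identity. The exponent \<open>j * (m + j - k)\<close> is a subtraction of natural numbers,
  but it is truncated only where \<open>k - j > m\<close>, and there the coefficient vanishes.\<close>

lemma gauss_binom_Vandermonde:
  "(\<Sum>j\<le>k. q ^ (j * (m + j - k)) * gauss_binom q m (k - j) * gauss_binom q n j) = gauss_binom q (m + n) k"
proof (induction n arbitrary: k)
  case 0
  have "(\<Sum>j\<le>k. q ^ (j * (m + j - k)) * gauss_binom q m (k - j) * gauss_binom q 0 j) =
      (\<Sum>j\<in>{0}. q ^ (j * (m + j - k)) * gauss_binom q m (k - j) * gauss_binom q 0 j)"
    by (rule sum.mono_neutral_right) auto
  then show ?case by simp
next
  case (Suc n)
  let ?t = "\<lambda>n k j. q ^ (j * (m + j - k)) * gauss_binom q m (k - j) * gauss_binom q n j"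
  show ?case
  proof (cases k)
    case 0
    then show ?thesis by simp
  next
    case k: (Suc k')
    show ?thesis
    proof (cases "k' \<le> m + n")
      case False
      then have "?t (Suc n) k j = 0" if "j \<le> k" for j
        using that k by (cases "j \<le> Suc n") auto
      then have "(\<Sum>j\<le>k. ?t (Suc n) k j) = 0"
        by (intro sum.neutral) simp
      then show ?thesis using False k by simp
    next
      case True
      have "?t (Suc n) k (Suc j) = ?t n k (Suc j) + q ^ (m + n - k') * ?t n k' j"
        if "j \<le> k'" for j
      proof (cases "j \<le> n \<and> k' - j \<le> m")
        case True
        then have "Suc j * (m + Suc j - k) + (n - j) = (m + n - k') + j * (m + j - k')"
        proof -
          define d where "d = m + j - k'"
          have "m + Suc j - k = d" "m + n - k' = d + (n - j)"
            using True that k by (auto simp: d_def)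
          then show ?thesis by (simp add: d_def)
        qed
        then have "q ^ (Suc j * (m + Suc j - k)) * q ^ (n - j) = q ^ (m + n - k') * q ^ (j * (m + j - k'))"
          by (metis power_add)
        then show ?thesis
          using True k by (simp add: gauss_binom_Pascal algebra_simps del: power_Suc)
      next
        case False
        then show ?thesis using k by auto
      qed
      then have "(\<Sum>j\<le>k. ?t (Suc n) k j) =
          ?t (Suc n) k 0 + (\<Sum>j\<le>k'. ?t n k (Suc j) + q ^ (m + n - k') * ?t n k' j)"
        unfolding k sum.atMost_Suc_shift by (simp add: k)
      also have "\<dots> = (\<Sum>j\<le>k. ?t n k j) + q ^ (m + n - k') * (\<Sum>j\<le>k'. ?t n k' j)"
        unfolding k sum.atMost_Suc_shift by (simp add: k sum.distrib sum_distrib_left)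
      also have "\<dots> = gauss_binom q (m + n) k + q ^ (m + n - k') * gauss_binom q (m + n) k'"
        by (simp only: Suc.IH)
      also have "\<dots> = gauss_binom q (m + Suc n) k"
        using True k by (simp add: gauss_binom_Pascal)
      finally show ?thesis .
    qed
  qed
qed

text \<open>As functions of \<open>k\<close>, the coefficients form a triangular matrix with unit diagonal, so they span all
  functions on \<open>{0..N}\<close>.\<close>

lemma gauss_binom_interpolation:
  "\<exists>\<alpha>. \<forall>k\<le>N. h k = (\<Sum>c\<le>N. \<alpha> c * gauss_binom q k c)"
proof (induction N)
  case 0
  show ?case by (rule exI[of _ h]) simp
next
  case (Suc N)
  then obtain \<alpha> where \<alpha>: "\<forall>k\<le>N. h k = (\<Sum>c\<le>N. \<alpha> c * gauss_binom q k c)" ..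
  define \<beta> where "\<beta> = \<alpha>(Suc N := h (Suc N) - (\<Sum>c\<le>N. \<alpha> c * gauss_binom q (Suc N) c))"
  have "(\<Sum>c\<le>N. \<beta> c * gauss_binom q k c) = (\<Sum>c\<le>N. \<alpha> c * gauss_binom q k c)" for k
    by (rule sum.cong) (auto simp: \<beta>_def)
  then have "\<forall>k\<le>Suc N. h k = (\<Sum>c\<le>Suc N. \<beta> c * gauss_binom q k c)"
    using \<alpha> by (auto simp: \<beta>_def le_Suc_eq)
  then show ?case by blast
qed

text \<open>Consequently a distribution of natural numbers is determined by its moments with respect to
  Gaussian binomials. This is how the number of subspaces with a given rank is recovered from the
  cardinality of a quiver Grassmannian.\<close>

lemma gauss_binom_moments_determine:
  fixes f :: "'i \<Rightarrow> nat" and w :: "nat \<Rightarrow> real" and g :: "nat \<Rightarrow> nat"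
  assumes moments: "\<And>c. (\<Sum>i\<in>I. gauss_binom q (f i) c) = (\<Sum>j\<in>J. w j * gauss_binom q (g j) c)"
    and bound: "\<And>i. i \<in> I \<Longrightarrow> f i \<le> N" "\<And>j. j \<in> J \<Longrightarrow> g j \<le> N"
  shows "(\<Sum>i\<in>I. h (f i)) = (\<Sum>j\<in>J. w j * h (g j))"
proof -
  obtain \<alpha> where \<alpha>: "\<And>k. k \<le> N \<Longrightarrow> h k = (\<Sum>c\<le>N. \<alpha> c * gauss_binom q k c)"
    using gauss_binom_interpolation[of N h] by blast
  have "(\<Sum>i\<in>I. h (f i)) = (\<Sum>c\<le>N. \<alpha> c * (\<Sum>i\<in>I. gauss_binom q (f i) c))"
    by (simp add: \<alpha> bound sum_distrib_left sum.swap[of _ I])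
  also have "\<dots> = (\<Sum>j\<in>J. w j * h (g j))"
    by (simp add: moments \<alpha> bound sum_distrib_left sum.swap[of _ J] mult.left_commute)
  finally show ?thesis .
qed

end

section \<open>Subspaces over a finite field\<close>

definition lin_subspace :: "nat \<Rightarrow> 'k::field vec set \<Rightarrow> bool" where
  "lin_subspace n U \<longleftrightarrow> U \<subseteq> carrier_vec n \<and> 0\<^sub>v n \<in> U \<and>
     (\<forall>u\<in>U. \<forall>v\<in>U. u + v \<in> U) \<and> (\<forall>c. \<forall>u\<in>U. c \<cdot>\<^sub>v u \<in> U)"

lemma lin_subspaceD:
  assumes "lin_subspace n U"
  shows "U \<subseteq> carrier_vec n" "u \<in> U \<Longrightarrow> u \<in> carrier_vec n" "0\<^sub>v n \<in> U"
    "u \<in> U \<Longrightarrow> v \<in> U \<Longrightarrow> u + v \<in> U" "u \<in> U \<Longrightarrow> c \<cdot>\<^sub>v u \<in> U"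
  using assms unfolding lin_subspace_def by (blast, blast, blast, blast, blast)

lemma lin_subspace_diff:
  assumes U: "lin_subspace n U" and u: "u \<in> U" and v: "v \<in> U"
  shows "u - v \<in> U"
proof -
  have "dim_vec u = n" "dim_vec v = n"
    using lin_subspaceD(2)[OF U u] lin_subspaceD(2)[OF U v] by (simp_all add: carrier_vecD)
  then have "u - v = u + (- 1) \<cdot>\<^sub>v v"
    by (intro eq_vecI) simp_all
  then show ?thesis using lin_subspaceD(4)[OF U u lin_subspaceD(5)[OF U v]] by metis
qed

lemma lin_subspace_carrier: "lin_subspace n (carrier_vec n)"
  by (simp add: lin_subspace_def)

lemma lin_subspace_zero: "lin_subspace n {0\<^sub>v n}"
  unfolding lin_subspace_def by (auto intro!: eq_vecI)

text \<open>The bridge to the locale-based notion of subspace. From here on dimensions are read off from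
  cardinalities, which are much easier to handle than bases.\<close>

lemma subspace_iff_lin_subspace:
  "subspace class_ring U (module_vec TYPE('k::field) n) \<longleftrightarrow> lin_subspace n U"
  unfolding VectorSpace.subspace_def submodule_def lin_subspace_def
  by (simp add: module_vec_simps vec_module vec_vs Ball_def) blast

lemma bij_betw_vec:
  "bij_betw (\<lambda>f. vec n f) ({..<n} \<rightarrow>\<^sub>E (UNIV :: 'a set)) (carrier_vec n)"
proof (rule bij_betw_byWitness[where f' = "\<lambda>v. restrict (vec_index v) {..<n}"])
  show "\<forall>f\<in>{..<n} \<rightarrow>\<^sub>E (UNIV :: 'a set). restrict (vec_index (vec n f)) {..<n} = f"
  proof
    fix f :: "nat \<Rightarrow> 'a" assume f: "f \<in> {..<n} \<rightarrow>\<^sub>E UNIV"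
    show "restrict (vec_index (vec n f)) {..<n} = f"
      by (rule ext) (simp add: restrict_def PiE_arb[OF f])
  qed
  show "\<forall>v\<in>carrier_vec n. vec n (restrict (vec_index v) {..<n}) = (v :: 'a vec)"
  proof
    fix v :: "'a vec" assume v: "v \<in> carrier_vec n"
    show "vec n (restrict (vec_index v) {..<n}) = v"
    proof (rule eq_vecI)
      show "dim_vec (vec n (restrict (vec_index v) {..<n})) = dim_vec v"
        using v by (simp add: carrier_vecD)
    next
      fix i assume "i < dim_vec v"
      then have "i < n" using v by (simp add: carrier_vecD)
      then show "vec n (restrict (vec_index v) {..<n}) $ i = v $ i"
        by (simp add: restrict_def)
    qed
  qed
  show "vec n ` ({..<n} \<rightarrow>\<^sub>E (UNIV :: 'a set)) \<subseteq> carrier_vec n"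
    by (rule image_subsetI) (rule vec_carrier)
  show "(\<lambda>v. restrict (vec_index v) {..<n}) ` carrier_vec n \<subseteq> {..<n} \<rightarrow>\<^sub>E (UNIV :: 'a set)"
    by (rule image_subsetI) (simp add: restrict_PiE_iff)
qed

lemma card_carrier_vec_field: "card (carrier_vec n :: 'k::finite vec set) = CARD('k) ^ n"
  using bij_betw_same_card[OF bij_betw_vec[where 'a = 'k], of n] by (simp add: card_PiE)

lemma finite_carrier_vec [simp]: "finite (carrier_vec n :: 'k::finite vec set)"
  using bij_betw_finite[OF bij_betw_vec[where 'a = 'k], of n] by (simp add: finite_PiE)

lemma finite_lin_subspace: "lin_subspace n U \<Longrightarrow> finite (U :: 'k::{field,finite} vec set)"
  using finite_subset[OF lin_subspaceD(1) finite_carrier_vec] .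

lemma field_order_gt_1: "1 < CARD('k::{field,finite})"
proof -
  have "card {0, 1 :: 'k} \<le> CARD('k)" by (rule card_mono) auto
  then show ?thesis by simp
qed

text \<open>Coordinates with respect to a basis identify \<open>U\<close> with the functions from the basis to the field.\<close>

lemma card_lin_subspace:
  fixes U :: "'k::{field,finite} vec set"
  assumes U: "lin_subspace n U"
  shows "card U = CARD('k) ^ subspace_dim n U"
proof -
  interpret V: vec_space "TYPE('k)" n .
  have "subspace class_ring U V.V"
    using U by (simp add: subspace_iff_lin_subspace)
  then interpret W: vectorspace class_ring "V.vs U"
    by (rule V.subspace_is_vs)
  have fin: "finite U" using U by (rule finite_lin_subspace)
  have "W.gen_set U"
    using W.in_own_span[of U] W.span_is_subset2[of U] by auto
  then have "W.fin_dim"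
    unfolding W.fin_dim_def using fin by auto
  then obtain B where B: "finite B" "W.basis B"
    using W.finite_basis_exists by blast
  have BU: "B \<subseteq> carrier (V.vs U)" using B(2) by (auto simp: W.basis_def)
  have uniq: "\<And>v. v \<in> U \<Longrightarrow> \<exists>!a. a \<in> B \<rightarrow>\<^sub>E UNIV \<and> W.lincomb a B = v"
    using W.basis_criterion[OF B(1) BU] B(2) by simp
  have "bij_betw (\<lambda>a. W.lincomb a B) (B \<rightarrow>\<^sub>E UNIV) U"
    unfolding bij_betw_def
  proof (intro conjI inj_onI equalityI subsetI)
    fix v assume "v \<in> (\<lambda>a. W.lincomb a B) ` (B \<rightarrow>\<^sub>E UNIV)"
    then obtain a where "v = W.lincomb a B" by blast
    then show "v \<in> U" using W.lincomb_closed[OF BU, of a] by simp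
  next
    fix v assume "v \<in> U"
    then show "v \<in> (\<lambda>a. W.lincomb a B) ` (B \<rightarrow>\<^sub>E UNIV)" using uniq by blast
  next
    fix a b assume ab: "a \<in> B \<rightarrow>\<^sub>E UNIV" "b \<in> B \<rightarrow>\<^sub>E UNIV" "W.lincomb a B = W.lincomb b B"
    have "W.lincomb a B \<in> U" using W.lincomb_closed[OF BU, of a] by simp
    then show "a = b" using uniq ab by metis
  qed
  then have "card U = card (B \<rightarrow>\<^sub>E (UNIV :: 'k set))"
    by (simp add: bij_betw_same_card)
  also have "\<dots> = CARD('k) ^ card B" using B(1) by (simp add: card_PiE)
  also have "card B = subspace_dim n U"
    unfolding subspace_dim_def using W.dim_basis[OF B] by simp
  finally show ?thesis .
qed

lemma subspace_dim_eq_iff: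
  fixes U :: "'k::{field,finite} vec set"
  assumes "lin_subspace n U"
  shows "subspace_dim n U = d \<longleftrightarrow> card U = CARD('k) ^ d"
  using card_lin_subspace[OF assms] field_order_gt_1[where 'k = 'k] by simp

lemma subspace_dim_carrier: "subspace_dim n (carrier_vec n :: 'k::{field,finite} vec set) = n"
  by (simp add: subspace_dim_eq_iff lin_subspace_carrier card_carrier_vec_field)

lemma subspace_dim_mono:
  fixes U :: "'k::{field,finite} vec set"
  assumes "lin_subspace n U" "lin_subspace n W" "U \<subseteq> W"
  shows "subspace_dim n U \<le> subspace_dim n W"
proof -
  have "card U \<le> card W" by (rule card_mono) (use assms finite_lin_subspace in auto)
  then show ?thesis
    using field_order_gt_1[where 'k = 'k] by (simp add: card_lin_subspace[OF assms(1)] card_lin_subspace[OF assms(2)])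
qed

lemma subspace_dim_le: "lin_subspace n (U :: 'k::{field,finite} vec set) \<Longrightarrow> subspace_dim n U \<le> n"
  using subspace_dim_mono[OF _ lin_subspace_carrier lin_subspaceD(1)] by (simp add: subspace_dim_carrier)

definition adjoin :: "'k::field vec set \<Rightarrow> 'k vec \<Rightarrow> 'k vec set" where
  "adjoin A v = (\<lambda>(u, c). u + c \<cdot>\<^sub>v v) ` (A \<times> UNIV)"

lemma adjoinI: "u \<in> A \<Longrightarrow> u + c \<cdot>\<^sub>v v \<in> adjoin A v"
  by (auto simp: adjoin_def)

lemma adjoin_subset:
  assumes "lin_subspace n U" "A \<subseteq> U" "v \<in> U"
  shows "adjoin A v \<subseteq> U"
  using assms by (auto simp: adjoin_def subset_iff intro!: lin_subspaceD(4,5)[OF assms(1)])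

lemma adjoin_superset:
  assumes A: "lin_subspace n A" and v: "v \<in> carrier_vec n"
  shows "A \<subseteq> adjoin A v" "v \<in> adjoin A v"
proof -
  have "u \<in> adjoin A v" if "u \<in> A" for u
  proof -
    have "u + 0 \<cdot>\<^sub>v v = u"
      using lin_subspaceD(2)[OF A that] v by (intro eq_vecI) auto
    then show ?thesis using adjoinI[OF that, of 0 v] by simp
  qed
  then show "A \<subseteq> adjoin A v" by blast
  have "0\<^sub>v n + 1 \<cdot>\<^sub>v v = v" using v by simp
  then show "v \<in> adjoin A v" using adjoinI[of "0\<^sub>v n" A 1 v] lin_subspaceD(3)[OF A] by simp
qed

lemma lin_subspace_adjoin:
  fixes A :: "'k::field vec set"
  assumes A: "lin_subspace n A" and v: "v \<in> carrier_vec n"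
  shows "lin_subspace n (adjoin A v)"
  unfolding lin_subspace_def
proof (intro conjI ballI allI)
  show "adjoin A v \<subseteq> carrier_vec n"
    using adjoin_subset[OF lin_subspace_carrier lin_subspaceD(1)[OF A] v] .
  show "0\<^sub>v n \<in> adjoin A v" using adjoin_superset(1)[OF assms] lin_subspaceD(3)[OF A] by blast
next
  fix x y assume "x \<in> adjoin A v" "y \<in> adjoin A v"
  then obtain u c u' c' where *: "x = u + c \<cdot>\<^sub>v v" "y = u' + c' \<cdot>\<^sub>v v" "u \<in> A" "u' \<in> A"
    by (auto simp: adjoin_def)
  then have "u \<in> carrier_vec n" "u' \<in> carrier_vec n" using lin_subspaceD(2)[OF A] by auto
  then have "x + y = (u + u') + (c + c') \<cdot>\<^sub>v v"
    using v * by (intro eq_vecI) (auto simp: algebra_simps)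
  then show "x + y \<in> adjoin A v" using adjoinI[of "u + u'" A] lin_subspaceD(4)[OF A] * by metis
next
  fix a x assume "x \<in> adjoin A v"
  then obtain u c where *: "x = u + c \<cdot>\<^sub>v v" "u \<in> A" by (auto simp: adjoin_def)
  then have "u \<in> carrier_vec n" using lin_subspaceD(2)[OF A] by auto
  then have "a \<cdot>\<^sub>v x = a \<cdot>\<^sub>v u + (a * c) \<cdot>\<^sub>v v"
    using v * by (intro eq_vecI) (auto simp: algebra_simps)
  then show "a \<cdot>\<^sub>v x \<in> adjoin A v" using adjoinI[of "a \<cdot>\<^sub>v u" A] lin_subspaceD(5)[OF A] * by metis
qed

lemma card_adjoin:
  fixes A :: "'k::{field,finite} vec set"
  assumes A: "lin_subspace n A" and v: "v \<in> carrier_vec n" "v \<notin> A"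
  shows "card (adjoin A v) = CARD('k) * card A"
proof -
  have "inj_on (\<lambda>(u, c). u + c \<cdot>\<^sub>v v) (A \<times> UNIV)"
  proof (rule inj_onI, clarsimp)
    fix u c u' c' assume uu: "u \<in> A" "u' \<in> A" and eq: "u + c \<cdot>\<^sub>v v = u' + c' \<cdot>\<^sub>v v"
    have car: "u \<in> carrier_vec n" "u' \<in> carrier_vec n" using lin_subspaceD(2)[OF A] uu by auto
    have entry: "u $ i + c * v $ i = u' $ i + c' * v $ i" if "i < n" for i
      using arg_cong[OF eq, of "\<lambda>w. w $ i"] that car v by simp
    have "c = c'"
    proof (rule ccontr)
      assume "c \<noteq> c'"
      then have "v = (1 / (c' - c)) \<cdot>\<^sub>v (u - u')"
        using car v entry by (intro eq_vecI) (auto simp: field_simps)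
      then show False using v(2) lin_subspaceD(5)[OF A] lin_subspace_diff[OF A uu] by metis
    qed
    moreover from this have "u = u'"
      using car entry by (intro eq_vecI) auto
    ultimately show "u = u' \<and> c = c'" by simp
  qed
  then show ?thesis
    by (simp add: adjoin_def card_image card_cartesian_product mult.commute)
qed

text \<open>Count the pairs \<open>(U, v)\<close> with \<open>A \<subseteq> U \<subseteq> B\<close> and \<open>v \<in> U - A\<close>. For fixed \<open>U\<close> there are \<open>q\<^sup>b - q\<^sup>d\<close> of them,
  for fixed \<open>v\<close> as many as there are subspaces above \<open>adjoin A v\<close>; the resulting recursion is the
  absorption identity of the Gaussian binomials.\<close>

lemma card_subspaces_above:
  fixes A B :: "'k::{field,finite} vec set"
  assumes "lin_subspace n A" "lin_subspace n B" "A \<subseteq> B"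
    and "card A = CARD('k) ^ d" "card B = CARD('k) ^ m"
  shows "real (card {U. lin_subspace n U \<and> A \<subseteq> U \<and> U \<subseteq> B \<and> card U = CARD('k) ^ (d + r)})
    = gauss_binom (CARD('k)) (m - d) r"
  using assms
proof (induction r arbitrary: A d)
  case 0
  have "U = A" if "lin_subspace n U" "A \<subseteq> U" "card U = card A" for U
    using that card_subset_eq[OF finite_lin_subspace] by metis
  then have "{U. lin_subspace n U \<and> A \<subseteq> U \<and> U \<subseteq> B \<and> card U = CARD('k) ^ (d + 0)} = {A}"
    using 0 by auto
  then show ?case using field_order_gt_1[where 'k = 'k] by simp
next
  case (Suc r)
  let ?q = "real CARD('k)"
  have q: "?q > 1" using field_order_gt_1[where 'k = 'k] by simp
  define b where "b = d + Suc r"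
  define F where "F = {U. lin_subspace n U \<and> A \<subseteq> U \<and> U \<subseteq> B \<and> card U = CARD('k) ^ b}"
  have fin: "finite B" using Suc.prems finite_lin_subspace by blast
  have finF: "finite F" by (rule finite_subset[of _ "Pow B"]) (auto simp: F_def fin)
  have "(\<Sum>U\<in>F. \<Sum>v | v \<in> B - A \<and> v \<in> U. 1) = (\<Sum>v\<in>B - A. \<Sum>U | U \<in> F \<and> v \<in> U. 1::real)"
    by (rule sum.swap_restrict) (use fin finF in auto)
  moreover have "(\<Sum>v | v \<in> B - A \<and> v \<in> U. 1) = ?q ^ b - ?q ^ d" if "U \<in> F" for U
  proof -
    have "{v. v \<in> B - A \<and> v \<in> U} = U - A" using that by (auto simp: F_def)
    moreover have "card (U - A) = card U - card A"
      using that Suc.prems by (intro card_Diff_subset finite_lin_subspace[of n A]) (auto simp: F_def)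
    moreover have "card A \<le> card U"
      using that by (intro card_mono) (auto simp: F_def finite_lin_subspace)
    ultimately show ?thesis using that Suc.prems by (simp add: F_def of_nat_diff)
  qed
  moreover have "(\<Sum>U | U \<in> F \<and> v \<in> U. 1) = gauss_binom ?q (m - Suc d) r" if v: "v \<in> B - A" for v
  proof -
    have vn: "v \<in> carrier_vec n" using v Suc.prems lin_subspaceD by blast
    let ?A = "adjoin A v"
    have "A \<subseteq> U \<and> v \<in> U \<longleftrightarrow> ?A \<subseteq> U" if "lin_subspace n U" for U
      using adjoin_superset[OF Suc.prems(1) vn] adjoin_subset[OF that] by blast
    then have "{U. U \<in> F \<and> v \<in> U} =
        {U. lin_subspace n U \<and> ?A \<subseteq> U \<and> U \<subseteq> B \<and> card U = CARD('k) ^ (Suc d + r)}"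
      by (auto simp: F_def b_def)
    moreover have "real (card \<dots>) = gauss_binom ?q (m - Suc d) r"
      by (rule Suc.IH)
         (use Suc.prems v vn in \<open>auto simp: lin_subspace_adjoin card_adjoin intro: adjoin_subset[THEN subsetD]\<close>)
    ultimately show ?thesis by simp
  qed
  ultimately have "real (card F) * (?q ^ b - ?q ^ d) = real (card (B - A)) * gauss_binom ?q (m - Suc d) r"
    by simp
  moreover have "real (card (B - A)) = ?q ^ m - ?q ^ d"
  proof -
    have "card (B - A) = card B - card A" "card A \<le> card B"
      using card_Diff_subset[OF finite_subset[OF Suc.prems(3) fin] Suc.prems(3)]
        card_mono[OF fin Suc.prems(3)] by blast+
    then show ?thesis using Suc.prems by (simp add: of_nat_diff)
  qed
  moreover have "d \<le> m"
  proof -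
    have "card A \<le> card B" using Suc.prems fin by (intro card_mono)
    then show ?thesis using q Suc.prems by simp
  qed
  ultimately have "?q ^ d * ((?q ^ Suc r - 1) * card F) = ?q ^ d * ((?q ^ (m - d) - 1) * gauss_binom ?q (m - Suc d) r)"
    by (simp add: b_def power_add[symmetric] algebra_simps)
  then have *: "(?q ^ Suc r - 1) * card F = (?q ^ (m - d) - 1) * gauss_binom ?q (m - Suc d) r"
    using q by simp
  also have "\<dots> = (?q ^ Suc r - 1) * gauss_binom ?q (m - d) (Suc r)"
  proof (cases "m = d")
    case True
    then show ?thesis using q by simp
  next
    case False
    then have "m - d = Suc (m - Suc d)" using \<open>d \<le> m\<close> by simp
    then show ?thesis using gauss_binom_absorption[OF q] by metis
  qed
  finally show ?case
    using power_Suc_gt_1[OF q, of r] unfolding F_def b_def by simp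
qed

text \<open>Expressed by codimensions the count is also correct, namely zero, if the dimension of \<open>A\<close>
  exceeds \<open>b\<close>.\<close>

lemma card_subspaces_above_codim:
  fixes A :: "'k::{field,finite} vec set"
  assumes A: "lin_subspace n A" and b: "b \<le> n"
  shows "real (card {U. lin_subspace n U \<and> A \<subseteq> U \<and> card U = CARD('k) ^ b})
    = gauss_binom (CARD('k)) (n - subspace_dim n A) (n - b)"
proof -
  let ?q = "real CARD('k)"
  have q: "?q > 1" using field_order_gt_1[where 'k = 'k] by simp
  let ?d = "subspace_dim n A"
  have d: "?d \<le> n" using A by (rule subspace_dim_le)
  show ?thesis
  proof (cases "?d \<le> b")
    case True
    have "real (card {U. lin_subspace n U \<and> A \<subseteq> U \<and> U \<subseteq> carrier_vec n \<and> card U = CARD('k) ^ (?d + (b - ?d))})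
      = gauss_binom ?q (n - ?d) (b - ?d)"
      by (rule card_subspaces_above)
         (use A in \<open>auto simp: lin_subspace_carrier lin_subspaceD(1)[OF A, THEN subsetD] card_lin_subspace[OF A] card_carrier_vec_field\<close>)
    moreover have "gauss_binom ?q (n - ?d) (b - ?d) = gauss_binom ?q (n - ?d) (n - b)"
      using gauss_binom_symmetric[OF q, of "b - ?d" "n - ?d"] True b by simp
    moreover have "{U. lin_subspace n U \<and> A \<subseteq> U \<and> U \<subseteq> carrier_vec n \<and> card U = CARD('k) ^ b}
        = {U. lin_subspace n U \<and> A \<subseteq> U \<and> card U = CARD('k) ^ b}"
      by (auto dest: lin_subspaceD(1))
    ultimately show ?thesis using True by simp
  next
    case False
    have "\<not> (lin_subspace n U \<and> A \<subseteq> U \<and> card U = CARD('k) ^ b)" for U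
      using False subspace_dim_mono[OF A, of U] subspace_dim_eq_iff[of n U b] by auto
    then have "{U. lin_subspace n U \<and> A \<subseteq> U \<and> card U = CARD('k) ^ b} = {}" by blast
    then have "card {U. lin_subspace n U \<and> A \<subseteq> U \<and> card U = CARD('k) ^ b} = 0"
      by (simp only: card.empty)
    then show ?thesis using False q d b by simp
  qed
qed

lemma card_subspaces_below:
  fixes B :: "'k::{field,finite} vec set"
  assumes B: "lin_subspace n B"
  shows "real (card {U. lin_subspace n U \<and> U \<subseteq> B \<and> card U = CARD('k) ^ b})
    = gauss_binom (CARD('k)) (subspace_dim n B) b"
proof -
  have "real (card {U. lin_subspace n U \<and> {0\<^sub>v n} \<subseteq> U \<and> U \<subseteq> B \<and> card U = CARD('k) ^ (0 + b)})
      = gauss_binom (CARD('k)) (subspace_dim n B - 0) b"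
    by (rule card_subspaces_above)
       (use B in \<open>auto simp: lin_subspace_zero card_lin_subspace[OF B] intro: lin_subspaceD(3)\<close>)
  moreover have "{U. lin_subspace n U \<and> {0\<^sub>v n} \<subseteq> U \<and> U \<subseteq> B \<and> card U = CARD('k) ^ (0 + b)}
      = {U. lin_subspace n U \<and> U \<subseteq> B \<and> card U = CARD('k) ^ b}"
    by (auto intro: lin_subspaceD(3))
  ultimately show ?thesis by simp
qed

section \<open>Quiver Grassmannians under a reflection\<close>

text \<open>Both arrows together form one map \<open>M\<^sub>1 \<oplus> M\<^sub>1 \<rightarrow> M\<^sub>2\<close>, the one whose kernel is the reflection of \<open>M\<close> at
  the sink. A pair \<open>(U, W)\<close> is a submodule if and only if \<open>W\<close> contains the image of \<open>U \<oplus> U\<close>, or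
  equivalently, if \<open>U\<close> is contained in the common preimage of \<open>W\<close>.\<close>

definition arrow_sum :: "'k::field kmod \<Rightarrow> 'k vec \<times> 'k vec \<Rightarrow> 'k vec" where
  "arrow_sum M = (\<lambda>(u, v). fst M *\<^sub>v u + snd M *\<^sub>v v)"

definition arrow_image :: "'k::field kmod \<Rightarrow> 'k vec set \<Rightarrow> 'k vec set" where
  "arrow_image M U = arrow_sum M ` (U \<times> U)"

lemma arrow_imageI: "u \<in> U \<Longrightarrow> v \<in> U \<Longrightarrow> arrow_sum M (u, v) \<in> arrow_image M U"
  unfolding arrow_image_def by (rule imageI) simp

lemma arrow_imageE:
  assumes "y \<in> arrow_image M U"
  obtains u v where "y = arrow_sum M (u, v)" "u \<in> U" "v \<in> U"
  using assms unfolding arrow_image_def by (elim imageE SigmaE) metis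

definition arrow_preimage :: "'k::field kmod \<Rightarrow> 'k vec set \<Rightarrow> 'k vec set" where
  "arrow_preimage N U = {x \<in> carrier_vec (dim1 N). fst N *\<^sub>v x \<in> U \<and> snd N *\<^sub>v x \<in> U}"

definition subspaces :: "nat \<Rightarrow> nat \<Rightarrow> 'k::field vec set set" where
  "subspaces n a = {U. lin_subspace n U \<and> card U = CARD('k) ^ a}"

lemma kmod_carrier:
  assumes "is_kmod M"
  shows "fst M \<in> carrier_mat (dim2 M) (dim1 M)" "snd M \<in> carrier_mat (dim2 M) (dim1 M)"
  using assms by (auto simp: is_kmod_def dim1_def dim2_def)

lemma arrow_closed:
  assumes "is_kmod M" "u \<in> carrier_vec (dim1 M)"
  shows "fst M *\<^sub>v u \<in> carrier_vec (dim2 M)" "snd M *\<^sub>v u \<in> carrier_vec (dim2 M)"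
  using kmod_carrier[OF assms(1)] assms(2) by (auto intro: mult_mat_vec_carrier)

lemma arrow_sum_closed:
  assumes "is_kmod M" "u \<in> carrier_vec (dim1 M)" "v \<in> carrier_vec (dim1 M)"
  shows "arrow_sum M (u, v) \<in> carrier_vec (dim2 M)"
  using arrow_closed[OF assms(1)] assms(2,3) by (simp add: arrow_sum_def)

lemma arrow_sum_add:
  assumes M: "is_kmod M" and "u \<in> carrier_vec (dim1 M)" "v \<in> carrier_vec (dim1 M)"
    "u' \<in> carrier_vec (dim1 M)" "v' \<in> carrier_vec (dim1 M)"
  shows "arrow_sum M (u + u', v + v') = arrow_sum M (u, v) + arrow_sum M (u', v')"
proof -
  have [simp]: "fst M *\<^sub>v (u + u') = fst M *\<^sub>v u + fst M *\<^sub>v u'"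
    "snd M *\<^sub>v (v + v') = snd M *\<^sub>v v + snd M *\<^sub>v v'"
    using mult_add_distrib_mat_vec kmod_carrier[OF M] assms by blast+
  have "dim_vec (fst M *\<^sub>v u) = dim2 M" "dim_vec (fst M *\<^sub>v u') = dim2 M"
    "dim_vec (snd M *\<^sub>v v) = dim2 M" "dim_vec (snd M *\<^sub>v v') = dim2 M"
    using kmod_carrier[OF M] by auto
  then show ?thesis
    unfolding arrow_sum_def by (intro eq_vecI) (simp_all add: add_ac del: dim_mult_mat_vec index_mult_mat_vec)
qed

lemma arrow_sum_smult:
  assumes M: "is_kmod M" and "u \<in> carrier_vec (dim1 M)" "v \<in> carrier_vec (dim1 M)"
  shows "arrow_sum M (c \<cdot>\<^sub>v u, c \<cdot>\<^sub>v v) = c \<cdot>\<^sub>v arrow_sum M (u, v)"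
proof -
  have "fst M *\<^sub>v (c \<cdot>\<^sub>v u) = c \<cdot>\<^sub>v (fst M *\<^sub>v u)" "snd M *\<^sub>v (c \<cdot>\<^sub>v v) = c \<cdot>\<^sub>v (snd M *\<^sub>v v)"
    using mult_mat_vec[OF kmod_carrier(1)[OF M]] mult_mat_vec[OF kmod_carrier(2)[OF M]] assms
    by blast+
  then show ?thesis
    using smult_add_distrib_vec[OF arrow_closed(1)[OF M assms(2)] arrow_closed(2)[OF M assms(3)]]
    by (simp add: arrow_sum_def)
qed

lemma lin_subspace_arrow_image:
  assumes M: "is_kmod M" and U: "lin_subspace (dim1 M) U"
  shows "lin_subspace (dim2 M) (arrow_image M U)"
  unfolding lin_subspace_def
proof (intro conjI ballI allI subsetI)
  note car = lin_subspaceD(2)[OF U]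
  show "x \<in> carrier_vec (dim2 M)" if "x \<in> arrow_image M U" for x
    using that by (rule arrow_imageE) (simp add: arrow_sum_closed[OF M] car)
  let ?z = "0\<^sub>v (dim1 M)"
  have z: "?z \<in> U" by (rule lin_subspaceD(3)[OF U])
  have "arrow_sum M (0 \<cdot>\<^sub>v ?z, 0 \<cdot>\<^sub>v ?z) = 0 \<cdot>\<^sub>v arrow_sum M (?z, ?z)"
    by (rule arrow_sum_smult[OF M]) simp_all
  also have "\<dots> = 0\<^sub>v (dim2 M)"
    using arrow_sum_closed[OF M zero_carrier_vec zero_carrier_vec] by (intro eq_vecI) auto
  finally show "0\<^sub>v (dim2 M) \<in> arrow_image M U"
    using arrow_imageI[OF lin_subspaceD(5)[OF U z] lin_subspaceD(5)[OF U z]] by metis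
  fix x assume "x \<in> arrow_image M U"
  then obtain u v where x: "x = arrow_sum M (u, v)" "u \<in> U" "v \<in> U"
    by (rule arrow_imageE)
  show "c \<cdot>\<^sub>v x \<in> arrow_image M U" for c
    using arrow_imageI[OF lin_subspaceD(5)[OF U x(2)] lin_subspaceD(5)[OF U x(3)]]
      arrow_sum_smult[OF M car[OF x(2)] car[OF x(3)]] x(1) by metis
  fix y assume "y \<in> arrow_image M U"
  then obtain u' v' where y: "y = arrow_sum M (u', v')" "u' \<in> U" "v' \<in> U"
    by (rule arrow_imageE)
  show "x + y \<in> arrow_image M U"
    using arrow_imageI[OF lin_subspaceD(4)[OF U x(2) y(2)] lin_subspaceD(4)[OF U x(3) y(3)]]
      arrow_sum_add[OF M car[OF x(2)] car[OF x(3)] car[OF y(2)] car[OF y(3)]] x(1) y(1) by metis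
qed

lemma arrow_image_subset_iff:
  assumes M: "is_kmod M" and U: "lin_subspace (dim1 M) U" and W: "lin_subspace (dim2 M) W"
  shows "arrow_image M U \<subseteq> W \<longleftrightarrow> (\<forall>u\<in>U. fst M *\<^sub>v u \<in> W \<and> snd M *\<^sub>v u \<in> W)"
proof
  assume "\<forall>u\<in>U. fst M *\<^sub>v u \<in> W \<and> snd M *\<^sub>v u \<in> W"
  then show "arrow_image M U \<subseteq> W"
    using lin_subspaceD(4)[OF W] by (auto simp: arrow_image_def arrow_sum_def)
next
  assume sub: "arrow_image M U \<subseteq> W"
  show "\<forall>u\<in>U. fst M *\<^sub>v u \<in> W \<and> snd M *\<^sub>v u \<in> W"
  proof
    fix u assume u: "u \<in> U"
    let ?z = "0\<^sub>v (dim1 M)"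
    have z: "?z \<in> U" by (rule lin_subspaceD(3)[OF U])
    have fz: "fst M *\<^sub>v ?z = 0\<^sub>v (dim2 M)" "snd M *\<^sub>v ?z = 0\<^sub>v (dim2 M)"
      using kmod_carrier[OF M] by (auto intro!: eq_vecI)
    have "arrow_sum M (u, ?z) \<in> W" "arrow_sum M (?z, u) \<in> W"
      using sub u z by (auto simp: arrow_image_def)
    then show "fst M *\<^sub>v u \<in> W \<and> snd M *\<^sub>v u \<in> W"
      using arrow_closed[OF M lin_subspaceD(2)[OF U u]] by (simp add: arrow_sum_def fz)
  qed
qed

lemma lin_subspace_arrow_preimage:
  assumes N: "is_kmod N" and U: "lin_subspace (dim2 N) U"
  shows "lin_subspace (dim1 N) (arrow_preimage N U)"
  unfolding lin_subspace_def
proof (intro conjI ballI allI)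
  show "arrow_preimage N U \<subseteq> carrier_vec (dim1 N)" by (auto simp: arrow_preimage_def)
  have "fst N *\<^sub>v 0\<^sub>v (dim1 N) = 0\<^sub>v (dim2 N)" "snd N *\<^sub>v 0\<^sub>v (dim1 N) = 0\<^sub>v (dim2 N)"
    using kmod_carrier[OF N] by (auto intro!: eq_vecI)
  then show "0\<^sub>v (dim1 N) \<in> arrow_preimage N U"
    using lin_subspaceD(3)[OF U] by (simp add: arrow_preimage_def)
next
  fix x y assume "x \<in> arrow_preimage N U" "y \<in> arrow_preimage N U"
  then have *: "x \<in> carrier_vec (dim1 N)" "y \<in> carrier_vec (dim1 N)"
      "fst N *\<^sub>v x \<in> U" "snd N *\<^sub>v x \<in> U" "fst N *\<^sub>v y \<in> U" "snd N *\<^sub>v y \<in> U"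
    by (auto simp: arrow_preimage_def)
  have "fst N *\<^sub>v (x + y) = fst N *\<^sub>v x + fst N *\<^sub>v y"
    "snd N *\<^sub>v (x + y) = snd N *\<^sub>v x + snd N *\<^sub>v y"
    using mult_add_distrib_mat_vec kmod_carrier[OF N] * by blast+
  then show "x + y \<in> arrow_preimage N U"
    using * lin_subspaceD(4)[OF U] by (simp add: arrow_preimage_def)
next
  fix c x assume "x \<in> arrow_preimage N U"
  then have *: "x \<in> carrier_vec (dim1 N)" "fst N *\<^sub>v x \<in> U" "snd N *\<^sub>v x \<in> U"
    by (auto simp: arrow_preimage_def)
  have "fst N *\<^sub>v (c \<cdot>\<^sub>v x) = c \<cdot>\<^sub>v (fst N *\<^sub>v x)" "snd N *\<^sub>v (c \<cdot>\<^sub>v x) = c \<cdot>\<^sub>v (snd N *\<^sub>v x)"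
    using mult_mat_vec[OF kmod_carrier(1)[OF N]] mult_mat_vec[OF kmod_carrier(2)[OF N]] * by blast+
  then show "c \<cdot>\<^sub>v x \<in> arrow_preimage N U"
    using * lin_subspaceD(5)[OF U] by (simp add: arrow_preimage_def)
qed

lemma finite_subspaces: "finite (subspaces n a :: 'k::{field,finite} vec set set)"
  by (rule finite_subset[of _ "Pow (carrier_vec n)"])
     (auto simp: subspaces_def dest: lin_subspaceD(2))

lemma Gr_iff:
  fixes M :: "'k::{field,finite} kmod"
  shows "(U, W) \<in> Gr (a, b) M \<longleftrightarrow> lin_subspace (dim1 M) U \<and> lin_subspace (dim2 M) W \<and>
    (\<forall>u\<in>U. fst M *\<^sub>v u \<in> W \<and> snd M *\<^sub>v u \<in> W) \<and>
    card U = CARD('k) ^ a \<and> card W = CARD('k) ^ b"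
  unfolding Gr_def submodules_def subspace_iff_lin_subspace
  using subspace_dim_eq_iff[of "dim1 M" U a] subspace_dim_eq_iff[of "dim2 M" W b] by auto

lemma Gr_eq:
  fixes M :: "'k::{field,finite} kmod"
  assumes M: "is_kmod M"
  shows "Gr (a, b) M = (SIGMA U : subspaces (dim1 M) a.
    {W. lin_subspace (dim2 M) W \<and> arrow_image M U \<subseteq> W \<and> card W = CARD('k) ^ b})"
proof (rule Set.set_eqI)
  fix p :: "'k vec set \<times> 'k vec set"
  obtain U W where p: "p = (U, W)" by (cases p)
  show "p \<in> Gr (a, b) M \<longleftrightarrow> p \<in> (SIGMA U : subspaces (dim1 M) a.
    {W. lin_subspace (dim2 M) W \<and> arrow_image M U \<subseteq> W \<and> card W = CARD('k) ^ b})"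
    unfolding p Gr_iff mem_Sigma_iff subspaces_def mem_Collect_eq
    using arrow_image_subset_iff[OF M, of U W] by blast
qed

text \<open>Choosing \<open>U\<close> first, the second component runs through the subspaces above \<open>arrow_image M U\<close>, so the
  quiver Grassmannian only depends on how the dimension of that image is distributed over the \<open>U\<close>.\<close>

lemma card_Gr_image:
  fixes M :: "'k::{field,finite} kmod"
  assumes M: "is_kmod M" and b: "b \<le> dim2 M"
  shows "real (card (Gr (a, b) M)) = (\<Sum>U\<in>subspaces (dim1 M) a.
    gauss_binom (CARD('k)) (dim2 M - subspace_dim (dim2 M) (arrow_image M U)) (dim2 M - b))"
proof -
  have "finite {W :: 'k vec set. lin_subspace (dim2 M) W \<and> P W}" for P
    by (rule finite_subset[of _ "Pow (carrier_vec (dim2 M))"]) (auto dest: lin_subspaceD(2))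
  then have "real (card (Gr (a, b) M)) = (\<Sum>U\<in>subspaces (dim1 M) a.
      real (card {W. lin_subspace (dim2 M) W \<and> arrow_image M U \<subseteq> W \<and> card W = CARD('k) ^ b}))"
    unfolding Gr_eq[OF M] by (subst card_SigmaI) (simp_all add: finite_subspaces)
  also have "\<dots> = (\<Sum>U\<in>subspaces (dim1 M) a.
    gauss_binom (CARD('k)) (dim2 M - subspace_dim (dim2 M) (arrow_image M U)) (dim2 M - b))"
    by (intro sum.cong refl card_subspaces_above_codim lin_subspace_arrow_image[OF M] b)
       (simp add: subspaces_def)
  finally show ?thesis .
qed

text \<open>The same with the component at the sink chosen first.\<close>

lemma card_Gr_preimage:
  fixes N :: "'k::{field,finite} kmod"
  assumes N: "is_kmod N"
  shows "real (card (Gr (c, a) N)) = (\<Sum>U\<in>subspaces (dim2 N) a.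
    gauss_binom (CARD('k)) (subspace_dim (dim1 N) (arrow_preimage N U)) c)"
proof -
  have fin: "finite {W :: 'k vec set. lin_subspace (dim1 N) W \<and> P W}" for P
    by (rule finite_subset[of _ "Pow (carrier_vec (dim1 N))"]) (auto dest: lin_subspaceD(2))
  have "bij_betw prod.swap (Gr (c, a) N) (SIGMA U : subspaces (dim2 N) a.
      {W. lin_subspace (dim1 N) W \<and> W \<subseteq> arrow_preimage N U \<and> card W = CARD('k) ^ c})"
    by (rule bij_betw_byWitness[where f' = prod.swap])
       (auto simp: Gr_iff subspaces_def arrow_preimage_def dest: lin_subspaceD(2))
  then have "real (card (Gr (c, a) N)) = (\<Sum>U\<in>subspaces (dim2 N) a.
      real (card {W. lin_subspace (dim1 N) W \<and> W \<subseteq> arrow_preimage N U \<and> card W = CARD('k) ^ c}))"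
    using fin by (simp add: bij_betw_same_card card_SigmaI finite_subspaces)
  also have "\<dots> = (\<Sum>U\<in>subspaces (dim2 N) a.
    gauss_binom (CARD('k)) (subspace_dim (dim1 N) (arrow_preimage N U)) c)"
    by (intro sum.cong refl card_subspaces_below lin_subspace_arrow_preimage[OF N])
       (simp add: subspaces_def)
  finally show ?thesis .
qed

text \<open>Rank-nullity for the restriction of the arrows to \<open>U \<oplus> U\<close>: all fibres are translates of the
  kernel.\<close>

lemma card_arrow_image_kernel:
  fixes M :: "'k::{field,finite} kmod"
  assumes M: "is_kmod M" and U: "lin_subspace (dim1 M) U"
  shows "card {p \<in> U \<times> U. arrow_sum M p = 0\<^sub>v (dim2 M)} * card (arrow_image M U) = card U * card U"
proof -
  let ?K = "{p \<in> U \<times> U. arrow_sum M p = 0\<^sub>v (dim2 M)}"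
  have fin: "finite (U \<times> U)" using finite_lin_subspace[OF U] by simp
  have fib: "card {p \<in> U \<times> U. arrow_sum M p = y} = card ?K" if yI: "y \<in> arrow_image M U" for y
  proof -
    obtain u0 v0 where y: "y = arrow_sum M (u0, v0)" "u0 \<in> U" "v0 \<in> U"
      using yI by (rule arrow_imageE)
    note car = lin_subspaceD(2)[OF U]
    have shift: "arrow_sum M (u + u0, v + v0) = arrow_sum M (u, v) + y" if "u \<in> U" "v \<in> U" for u v
      unfolding y(1) using arrow_sum_add[OF M] car that y by blast
    have closed: "arrow_sum M (u, v) \<in> carrier_vec (dim2 M)" if "u \<in> U" "v \<in> U" for u v
      using arrow_sum_closed[OF M] car that by blast
    have yc: "y \<in> carrier_vec (dim2 M)" using closed y by blast
    have cancel: "(u - w) + w = u" "(u + w) - w = u" if "u \<in> U" "w \<in> U" for u w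
      using car[OF that(1)] car[OF that(2)] by (intro eq_vecI; simp)+
    have "bij_betw (\<lambda>(u, v). (u + u0, v + v0)) ?K {p \<in> U \<times> U. arrow_sum M p = y}"
    proof (rule bij_betw_byWitness[where f' = "\<lambda>(u, v). (u - u0, v - v0)"])
      show "(\<lambda>(u, v). (u + u0, v + v0)) ` ?K \<subseteq> {p \<in> U \<times> U. arrow_sum M p = y}"
        using y lin_subspaceD(4)[OF U] shift yc by auto
      show "(\<lambda>(u, v). (u - u0, v - v0)) ` {p \<in> U \<times> U. arrow_sum M p = y} \<subseteq> ?K"
      proof (rule image_subsetI)
        fix p assume "p \<in> {p \<in> U \<times> U. arrow_sum M p = y}"
        then obtain u v where p: "p = (u, v)" and uv: "u \<in> U" "v \<in> U" "y = arrow_sum M (u, v)"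
          by (cases p) simp
        have d: "u - u0 \<in> U" "v - v0 \<in> U"
          using uv y lin_subspace_diff[OF U] by auto
        then have e: "arrow_sum M (u - u0, v - v0) + y = y"
          using shift[OF d] cancel(1)[OF uv(1) y(2)] cancel(1)[OF uv(2) y(3)] uv(3) by simp
        have "arrow_sum M (u - u0, v - v0) = 0\<^sub>v (dim2 M)"
        proof (rule eq_vecI)
          fix i assume "i < dim_vec (0\<^sub>v (dim2 M) :: 'k vec)"
          then show "arrow_sum M (u - u0, v - v0) $ i = 0\<^sub>v (dim2 M) $ i"
            using arg_cong[OF e, of "\<lambda>w. w $ i"] closed[OF d] yc by auto
        qed (use closed[OF d] in auto)
        then show "(case p of (u, v) \<Rightarrow> (u - u0, v - v0)) \<in> ?K" using d p by simp
      qed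
    qed (use y cancel in auto)
    then show ?thesis by (simp add: bij_betw_same_card)
  qed
  have "card (U \<times> U) = (\<Sum>y\<in>arrow_sum M ` (U \<times> U). \<Sum>p | p \<in> U \<times> U \<and> arrow_sum M p = y. 1)"
    using sum.image_gen[OF fin, of "\<lambda>_. 1::nat" "arrow_sum M"] by (simp only: card_eq_sum)
  also have "\<dots> = (\<Sum>y\<in>arrow_image M U. card ?K)"
    unfolding arrow_image_def[symmetric] by (rule sum.cong) (simp_all add: fib)
  finally show ?thesis by (simp add: card_cartesian_product mult.commute)
qed

lemma sink_reflectionD:
  assumes "sink_reflection M N"
  shows "is_kmod M" "is_kmod N" "dim2 N = dim1 M"
    "bij_betw (\<lambda>x. (fst N *\<^sub>v x, snd N *\<^sub>v x)) (carrier_vec (dim1 N))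
      {p \<in> carrier_vec (dim1 M) \<times> carrier_vec (dim1 M). arrow_sum M p = 0\<^sub>v (dim2 M)}"
proof -
  have "{p \<in> carrier_vec (dim1 M) \<times> carrier_vec (dim1 M). arrow_sum M p = 0\<^sub>v (dim2 M)} =
    {(u, v) \<in> carrier_vec (dim1 M) \<times> carrier_vec (dim1 M). fst M *\<^sub>v u + snd M *\<^sub>v v = 0\<^sub>v (dim2 M)}"
    by (auto simp: arrow_sum_def)
  then show "is_kmod M" "is_kmod N" "dim2 N = dim1 M"
    "bij_betw (\<lambda>x. (fst N *\<^sub>v x, snd N *\<^sub>v x)) (carrier_vec (dim1 N))
      {p \<in> carrier_vec (dim1 M) \<times> carrier_vec (dim1 M). arrow_sum M p = 0\<^sub>v (dim2 M)}"
    using assms by (auto simp: sink_reflection_def)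
qed

text \<open>A subspace \<open>U\<close> of \<open>M\<^sub>1 = N\<^sub>2\<close> belongs to both modules of a reflection. The preimage of \<open>U\<close> in \<open>N\<^sub>1\<close> is
  the kernel of \<open>U \<oplus> U \<rightarrow> M\<^sub>2\<close>, so the distribution that determines the quiver Grassmannians of \<open>M\<close> with
  first component of a given dimension also determines those of \<open>N\<close> with such a second component, and
  conversely.\<close>

lemma dim_preimage_image:
  fixes M :: "'k::{field,finite} kmod"
  assumes R: "sink_reflection M N" and U: "lin_subspace (dim1 M) U"
  shows "subspace_dim (dim1 N) (arrow_preimage N U) + subspace_dim (dim2 M) (arrow_image M U)
    = 2 * subspace_dim (dim1 M) U"
proof -
  note R' = sink_reflectionD[OF R]
  note sub = lin_subspaceD(2)[OF U]
  let ?f = "\<lambda>x. (fst N *\<^sub>v x, snd N *\<^sub>v x)"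
  have "arrow_preimage N U \<subseteq> carrier_vec (dim1 N)" by (auto simp: arrow_preimage_def)
  moreover have "?f ` arrow_preimage N U = {p \<in> U \<times> U. arrow_sum M p = 0\<^sub>v (dim2 M)}"
  proof (intro equalityI subsetI)
    fix p assume "p \<in> ?f ` arrow_preimage N U"
    then obtain x where x: "p = ?f x" "x \<in> arrow_preimage N U" by blast
    then have "?f x \<in> {p \<in> carrier_vec (dim1 M) \<times> carrier_vec (dim1 M). arrow_sum M p = 0\<^sub>v (dim2 M)}"
      using bij_betw_apply[OF R'(4)] by (simp add: arrow_preimage_def)
    then show "p \<in> {p \<in> U \<times> U. arrow_sum M p = 0\<^sub>v (dim2 M)}"
      using x by (simp add: arrow_preimage_def)
  next
    fix p assume p: "p \<in> {p \<in> U \<times> U. arrow_sum M p = 0\<^sub>v (dim2 M)}"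
    then have "p \<in> ?f ` carrier_vec (dim1 N)"
      unfolding bij_betw_imp_surj_on[OF R'(4)] using sub by auto
    then show "p \<in> ?f ` arrow_preimage N U"
      using p by (auto simp: arrow_preimage_def)
  qed
  ultimately have "bij_betw ?f (arrow_preimage N U) {p \<in> U \<times> U. arrow_sum M p = 0\<^sub>v (dim2 M)}"
    by (rule bij_betw_subset[OF R'(4)])
  then have "card (arrow_preimage N U) * card (arrow_image M U) = card U * card U"
    using card_arrow_image_kernel[OF R'(1) U] by (simp add: bij_betw_same_card)
  moreover have "lin_subspace (dim1 N) (arrow_preimage N U)" "lin_subspace (dim2 M) (arrow_image M U)"
    using lin_subspace_arrow_preimage[OF R'(2)] lin_subspace_arrow_image[OF R'(1)] U R'(3) by auto
  ultimately have "CARD('k) ^ (subspace_dim (dim1 N) (arrow_preimage N U)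
      + subspace_dim (dim2 M) (arrow_image M U)) = CARD('k) ^ (2 * subspace_dim (dim1 M) U)"
    using U R'(3) by (simp add: card_lin_subspace[of "dim1 N"] card_lin_subspace[of "dim2 M"]
        card_lin_subspace[OF U] power_add mult_2)
  then show ?thesis
    using field_order_gt_1[where 'k = 'k] by simp
qed

context
  fixes q :: real
  assumes q: "q > 1"
begin

text \<open>The weights \<open>q ^ (j * (s + j - a)) * gauss_binom q s (a - j) * gauss_binom q n j\<close> are, for
  \<open>s = a - 1\<close> and \<open>s = a + 1\<close>, the numbers of subspaces of dimension \<open>a\<close> whose image under the two arrows has
  dimension \<open>a + j\<close>, in the preprojective and in the preinjective case. Both kinds of moments that
  occur on the two sides of a reflection reduce to the \<open>q\<close>-Vandermonde identity.\<close>

lemma gauss_binom_sum_trinomial_low: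
  "(\<Sum>j\<le>a. q ^ (j * (s + j - a)) * gauss_binom q s (a - j) * gauss_binom q n j * gauss_binom q (a - j) c) =
    (if c \<le> a then gauss_binom q s c * gauss_binom q (s + n - c) (a - c) else 0)"
proof (cases "c \<le> a \<and> c \<le> s")
  case False
  have "gauss_binom q s (a - j) * gauss_binom q (a - j) c = 0" for j
    using False q by (cases "a - j \<le> s") auto
  then have "q ^ (j * (s + j - a)) * gauss_binom q s (a - j) * gauss_binom q n j * gauss_binom q (a - j) c = 0" for j
    by (metis mult.assoc mult.commute mult_zero_right)
  then show ?thesis using False q by auto
next
  case True
  have "(\<Sum>j\<le>a. q ^ (j * (s + j - a)) * gauss_binom q s (a - j) * gauss_binom q n j * gauss_binom q (a - j) c) =
      (\<Sum>j\<le>a - c. q ^ (j * (s + j - a)) * gauss_binom q s (a - j) * gauss_binom q n j * gauss_binom q (a - j) c)"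
    by (rule sum.mono_neutral_right) (use q in auto)
  also have "\<dots> = (\<Sum>j\<le>a - c. gauss_binom q s c *
      (q ^ (j * ((s - c) + j - (a - c))) * gauss_binom q (s - c) (a - c - j) * gauss_binom q n j))"
  proof (rule sum.cong[OF refl])
    fix j assume "j \<in> {..a - c}"
    then have j: "c \<le> a - j" using True by auto
    have "gauss_binom q s (a - j) * gauss_binom q (a - j) c = gauss_binom q s c * gauss_binom q (s - c) (a - j - c)"
    proof (cases "a - j \<le> s")
      case True
      then show ?thesis using j by (intro gauss_binom_trinomial[OF q])
    next
      case False
      then have "s < a - j" by simp
      moreover from this have "s - c < a - j - c" using \<open>c \<le> a \<and> c \<le> s\<close> by arith
      ultimately show ?thesis using gauss_binom_eq_0[OF q] by simp
    qed
    moreover have "s - c + j - (a - c) = s + j - a" "a - j - c = a - c - j"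
      using True j by auto
    ultimately show "q ^ (j * (s + j - a)) * gauss_binom q s (a - j) * gauss_binom q n j * gauss_binom q (a - j) c =
        gauss_binom q s c * (q ^ (j * ((s - c) + j - (a - c))) * gauss_binom q (s - c) (a - c - j) * gauss_binom q n j)"
      by (simp add: ac_simps)
  qed
  also have "\<dots> = gauss_binom q s c * gauss_binom q (s + n - c) (a - c)"
    unfolding sum_distrib_left[symmetric] gauss_binom_Vandermonde[OF q] using True by simp
  finally show ?thesis using True by simp
qed

lemma gauss_binom_sum_trinomial_high:
  "(\<Sum>j\<le>a. q ^ (j * (s + j - a)) * gauss_binom q s (a - j) * gauss_binom q n j * gauss_binom q (n - j) c) =
    gauss_binom q n c * gauss_binom q (s + (n - c)) a"
proof -
  have "q ^ (j * (s + j - a)) * gauss_binom q s (a - j) * gauss_binom q n j * gauss_binom q (n - j) c =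
      gauss_binom q n c * (q ^ (j * (s + j - a)) * gauss_binom q s (a - j) * gauss_binom q (n - c) j)" for j
    using gauss_binom_mult_swap[OF q, of n j c] by (simp add: mult.assoc mult.left_commute)
  then show ?thesis
    by (simp only: gauss_binom_Vandermonde[OF q] sum_distrib_left[symmetric])
qed

end

section \<open>The quiver Grassmannians of preprojective and preinjective modules\<close>

lemma subspaces_empty:
  assumes "n < a"
  shows "subspaces n a = ({} :: 'k::{field,finite} vec set set)"
  using assms subspace_dim_le[where 'k = 'k, of n] subspace_dim_eq_iff[where 'k = 'k, of n]
  unfolding subspaces_def by force

lemma subspaces_0: "subspaces n 0 = ({{0\<^sub>v n}} :: 'k::{field,finite} vec set set)"
  unfolding subspaces_def
proof (intro equalityI subsetI)
  fix U assume "U \<in> {U :: 'k vec set. lin_subspace n U \<and> card U = CARD('k) ^ 0}"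
  then have U: "lin_subspace n U" "card U = 1" by simp_all
  then show "U \<in> {{0\<^sub>v n}}"
    using lin_subspaceD(3)[OF U(1)] by (auto simp: card_1_singleton_iff)
qed (auto simp: lin_subspace_zero)

lemma subspaces_full: "subspaces n n = ({carrier_vec n} :: 'k::{field,finite} vec set set)"
  unfolding subspaces_def
proof (intro equalityI subsetI)
  fix U assume "U \<in> {U :: 'k vec set. lin_subspace n U \<and> card U = CARD('k) ^ n}"
  then have U: "lin_subspace n U" "card U = card (carrier_vec n :: 'k vec set)"
    by (simp_all add: card_carrier_vec_field)
  then show "U \<in> {carrier_vec n}"
    using card_subset_eq[OF finite_carrier_vec lin_subspaceD(1)[OF U(1)] U(2)] by simp
qed (auto simp: lin_subspace_carrier card_carrier_vec_field)

lemma dim_arrow_image_le: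
  fixes M :: "'k::{field,finite} kmod"
  assumes "is_kmod M" "lin_subspace (dim1 M) U"
  shows "subspace_dim (dim2 M) (arrow_image M U) \<le> dim2 M"
  using subspace_dim_le[OF lin_subspace_arrow_image[OF assms]] .

lemma arrow_preimage_carrier:
  assumes "is_kmod N"
  shows "arrow_preimage N (carrier_vec (dim2 N)) = carrier_vec (dim1 N)"
  using arrow_closed[OF assms] unfolding arrow_preimage_def by blast

lemma sink_reflection_dim1:
  fixes M :: "'k::{field,finite} kmod"
  assumes R: "sink_reflection M N"
  shows "dim1 N + subspace_dim (dim2 M) (arrow_image M (carrier_vec (dim1 M))) = 2 * dim1 M"
  using dim_preimage_image[OF R lin_subspace_carrier] arrow_preimage_carrier[OF sink_reflectionD(2)[OF R]]
  by (simp add: subspace_dim_carrier sink_reflectionD(3)[OF R])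

text \<open>Under a reflection, \<open>dim2 - dim1\<close> drops by the codimension of the image of the arrows. If \<open>M\<close> has
  dimension \<open>(l, l + 1)\<close> with \<open>l > 0\<close>, its reflection is not \<open>0\<close>, so that the difference remains \<open>1\<close> and
  the reflection has dimension \<open>(l - 1, l)\<close>.\<close>

lemma preprojective_defect:
  fixes M :: "'k::{field,finite} kmod"
  assumes "preprojective M"
  shows "dim1 M \<le> dim2 M \<and> (dim1 M = dim2 M \<longrightarrow> dim1 M = 0)"
  using assms
proof induction
  case (1 M)
  then show ?case by (simp add: dimvec_def)
next
  case (2 M N)
  have "subspace_dim (dim2 M) (arrow_image M (carrier_vec (dim1 M))) \<le> dim2 M"
    using dim_arrow_image_le[OF sink_reflectionD(1)[OF 2(1)] lin_subspace_carrier] .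
  then show ?case
    using sink_reflection_dim1[OF 2(1)] sink_reflectionD(3)[OF 2(1)] 2(3) by linarith
qed

lemma source_reflectionD:
  assumes "source_reflection M N"
  shows "is_kmod M" "is_kmod N" "dim1 N = dim2 M"
    "arrow_image N (carrier_vec (dim1 N)) = carrier_vec (dim2 N)"
    "{p \<in> carrier_vec (dim1 N) \<times> carrier_vec (dim1 N). arrow_sum N p = 0\<^sub>v (dim2 N)} =
      (\<lambda>x. (fst M *\<^sub>v x, snd M *\<^sub>v x)) ` carrier_vec (dim1 M)"
proof -
  have "{p \<in> carrier_vec (dim2 M) \<times> carrier_vec (dim2 M). arrow_sum N p = 0\<^sub>v (dim2 N)} =
    {(u, v) \<in> carrier_vec (dim2 M) \<times> carrier_vec (dim2 M). fst N *\<^sub>v u + snd N *\<^sub>v v = 0\<^sub>v (dim2 N)}"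
    by (auto simp: arrow_sum_def)
  then show "is_kmod M" "is_kmod N" "dim1 N = dim2 M"
    "arrow_image N (carrier_vec (dim1 N)) = carrier_vec (dim2 N)"
    "{p \<in> carrier_vec (dim1 N) \<times> carrier_vec (dim1 N). arrow_sum N p = 0\<^sub>v (dim2 N)} =
      (\<lambda>x. (fst M *\<^sub>v x, snd M *\<^sub>v x)) ` carrier_vec (dim1 M)"
    using assms by (simp_all add: source_reflection_def arrow_image_def arrow_sum_def)
qed

text \<open>A source reflection provides the kernel of the arrows of \<open>N\<close> only as the image of \<open>M\<^sub>1\<close>. The map from
  \<open>M\<^sub>1\<close> onto it is injective if and only if the dimensions match; in that case the reflection can be
  read backwards as a sink reflection.\<close>

lemma card_source_kernel:
  fixes M :: "'k::{field,finite} kmod"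
  assumes R: "source_reflection M N"
  shows "card ((\<lambda>x. (fst M *\<^sub>v x, snd M *\<^sub>v x)) ` carrier_vec (dim1 M)) * CARD('k) ^ dim2 N
    = CARD('k) ^ (2 * dim2 M)"
  using card_arrow_image_kernel[OF source_reflectionD(2)[OF R] lin_subspace_carrier]
  unfolding source_reflectionD(4,5)[OF R]
  by (simp add: card_carrier_vec_field source_reflectionD(3)[OF R] mult_2 power_add)

lemma source_reflection_dim1:
  fixes M :: "'k::{field,finite} kmod"
  assumes R: "source_reflection M N"
  shows "2 * dim2 M \<le> dim1 M + dim2 N"
proof -
  have "CARD('k) ^ (2 * dim2 M) \<le> CARD('k) ^ dim1 M * CARD('k) ^ dim2 N"
    unfolding card_source_kernel[OF R, symmetric] card_carrier_vec_field[symmetric, of "dim1 M"]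
    by (intro mult_right_mono card_image_le) simp_all
  then show ?thesis
    using field_order_gt_1[where 'k = 'k] by (simp flip: power_add)
qed

lemma sink_reflection_of_source_reflection:
  fixes M :: "'k::{field,finite} kmod"
  assumes R: "source_reflection M N" and dim: "2 * dim2 M = dim1 M + dim2 N"
  shows "sink_reflection N M"
proof -
  let ?f = "\<lambda>x. (fst M *\<^sub>v x, snd M *\<^sub>v x)"
  have "card (?f ` carrier_vec (dim1 M)) = card (carrier_vec (dim1 M) :: 'k vec set)"
    using card_source_kernel[OF R] by (simp add: dim power_add card_carrier_vec_field)
  then have "inj_on ?f (carrier_vec (dim1 M))"
    by (rule eq_card_imp_inj_on[OF finite_carrier_vec])
  then have "bij_betw ?f (carrier_vec (dim1 M))
      {p \<in> carrier_vec (dim1 N) \<times> carrier_vec (dim1 N). arrow_sum N p = 0\<^sub>v (dim2 N)}"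
    unfolding source_reflectionD(5)[OF R] by (rule inj_on_imp_bij_betw)
  moreover have "{p \<in> carrier_vec (dim1 N) \<times> carrier_vec (dim1 N). arrow_sum N p = 0\<^sub>v (dim2 N)} =
    {(u, v) \<in> carrier_vec (dim1 N) \<times> carrier_vec (dim1 N). fst N *\<^sub>v u + snd N *\<^sub>v v = 0\<^sub>v (dim2 N)}"
    by (auto simp: arrow_sum_def)
  ultimately show ?thesis
    unfolding sink_reflection_def by (simp add: source_reflectionD(1-3)[OF R])
qed

lemma preinjective_defect:
  fixes M :: "'k::{field,finite} kmod"
  assumes "preinjective M"
  shows "dim2 M \<le> dim1 M \<and> (dim1 M = dim2 M \<longrightarrow> dim1 M = 0)"
  using assms
proof induction
  case (1 M)
  then show ?case by (simp add: dimvec_def)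
next
  case (2 M N)
  show ?case
    using source_reflection_dim1[OF 2(1)] source_reflectionD(3)[OF 2(1)] 2(3) by linarith
qed

text \<open>From the reflection \<open>N\<close> to \<open>M\<close>: the hypothesis on \<open>N\<close> gives the moments of the dimension of the
  preimages, hence their distribution, hence the quiver Grassmannian of \<open>M\<close>.\<close>

lemma card_Gr_step_preprojective:
  fixes M N :: "'k::{field,finite} kmod"
  assumes R: "sink_reflection M N" and dims: "dim1 M = l" "dim2 M = l + 1"
    and a: "1 \<le> a" "a \<le> l" and b: "b \<le> l + 1"
    and N: "\<And>c. real (card (Gr (c, a) N)) = gauss_binom (CARD('k)) (l - c) (l - a) * gauss_binom (CARD('k)) (a - 1) c"
  shows "real (card (Gr (a, b) M)) =
    gauss_binom (CARD('k)) (l + 1 - a) (l + 1 - b) * gauss_binom (CARD('k)) (b - 1) a"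
proof -
  let ?q = "real CARD('k)"
  have q: "?q > 1" using field_order_gt_1[where 'k = 'k] by simp
  note R' = sink_reflectionD[OF R]
  define f where "f = (\<lambda>U. subspace_dim (dim1 N) (arrow_preimage N U))"
  define w where "w = (\<lambda>j. ?q ^ (j * (a - 1 + j - a)) * gauss_binom ?q (a - 1) (a - j) * gauss_binom ?q (l + 1 - a) j)"
  have dim: "f U + subspace_dim (dim2 M) (arrow_image M U) = 2 * a" if "U \<in> subspaces l a" for U
    using that dim_preimage_image[OF R, of U] dims
    by (auto simp: f_def subspaces_def subspace_dim_eq_iff[symmetric])
  have moments: "(\<Sum>U\<in>subspaces l a. gauss_binom ?q (f U) c) = (\<Sum>j\<le>a. w j * gauss_binom ?q (a - j) c)" for c
  proof -
    have "(\<Sum>U\<in>subspaces l a. gauss_binom ?q (f U) c) = real (card (Gr (c, a) N))"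
      unfolding f_def card_Gr_preimage[OF R'(2)] by (simp add: R'(3) dims)
    also have "\<dots> = gauss_binom ?q (l - c) (l - a) * gauss_binom ?q (a - 1) c" by (rule N)
    also have "\<dots> = (\<Sum>j\<le>a. w j * gauss_binom ?q (a - j) c)"
    proof (cases "c \<le> a")
      case True
      then have "gauss_binom ?q (l - c) (l - a) = gauss_binom ?q (l - c) (a - c)"
        using gauss_binom_symmetric[OF q, of "a - c" "l - c"] a by simp
      then show ?thesis
        unfolding w_def gauss_binom_sum_trinomial_low[OF q] using True a by simp
    next
      case False
      then show ?thesis unfolding w_def gauss_binom_sum_trinomial_low[OF q] using a q by simp
    qed
    finally show ?thesis .
  qed
  \<comment> \<open>\<open>2 * a - f U\<close> is the dimension of the image of \<open>U\<close>, now a function of that of the preimage.\<close>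
  have "real (card (Gr (a, b) M)) =
      (\<Sum>U\<in>subspaces l a. gauss_binom ?q (l + 1 - (2 * a - f U)) (l + 1 - b))"
    using b by (subst card_Gr_image[OF R'(1)]) (auto simp: dims dim[symmetric] intro!: sum.cong)
  also have "\<dots> = (\<Sum>j\<le>a. w j * gauss_binom ?q (l + 1 - (2 * a - (a - j))) (l + 1 - b))"
    by (rule gauss_binom_moments_determine[OF q moments, where N = "2 * a"]) (use dim in force)+
  also have "\<dots> = (\<Sum>j\<le>a. w j * gauss_binom ?q ((l + 1 - a) - j) (l + 1 - b))"
    by (rule sum.cong) auto
  also have "\<dots> = gauss_binom ?q (l + 1 - a) (l + 1 - b) * gauss_binom ?q (a - 1 + (l + 1 - a - (l + 1 - b))) a"
    unfolding w_def by (rule gauss_binom_sum_trinomial_high[OF q])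
  also have "\<dots> = gauss_binom ?q (l + 1 - a) (l + 1 - b) * gauss_binom ?q (b - 1) a"
  proof (cases "a \<le> b")
    case True
    then have "a - 1 + (l + 1 - a - (l + 1 - b)) = b - 1" using a b by simp
    then show ?thesis by simp
  next
    case False
    then show ?thesis using a b q by simp
  qed
  finally show ?thesis .
qed

text \<open>The same step in the opposite direction: the quiver Grassmannians of \<open>N\<close> give the moments of the
  codimension of the images.\<close>

lemma card_Gr_step_preinjective:
  fixes M N :: "'k::{field,finite} kmod"
  assumes R: "sink_reflection N M" and dims: "dim1 N = l + 1" "dim2 N = l" and a: "a \<le> l"
    and N: "\<And>b. b \<le> l \<Longrightarrow>
      real (card (Gr (a, b) N)) = gauss_binom (CARD('k)) (b + 1) a * gauss_binom (CARD('k)) (l - a) (l - b)"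
  shows "real (card (Gr (c, a) M)) =
    gauss_binom (CARD('k)) (a + 1) c * gauss_binom (CARD('k)) (l + 1 - c) (l + 1 - a)"
proof -
  let ?q = "real CARD('k)"
  have q: "?q > 1" using field_order_gt_1[where 'k = 'k] by simp
  note R' = sink_reflectionD[OF R]
  define d where "d = (\<lambda>U. subspace_dim (dim2 N) (arrow_image N U))"
  define w where "w = (\<lambda>j. ?q ^ (j * (a + 1 + j - a)) * gauss_binom ?q (a + 1) (a - j) * gauss_binom ?q (l - a) j)"
  have dim: "subspace_dim (dim1 M) (arrow_preimage M U) + d U = 2 * a" "d U \<le> l"
    if "U \<in> subspaces (l + 1) a" for U
    using that dim_preimage_image[OF R, of U] dims dim_arrow_image_le[OF R'(1), of U]
    by (auto simp: d_def subspaces_def subspace_dim_eq_iff[symmetric])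
  have moments: "(\<Sum>U\<in>subspaces (l + 1) a. gauss_binom ?q (l - d U) e) = (\<Sum>j\<le>a. w j * gauss_binom ?q (l - a - j) e)" for e
  proof (cases "e \<le> l")
    case True
    have "(\<Sum>U\<in>subspaces (l + 1) a. gauss_binom ?q (l - d U) e) = real (card (Gr (a, l - e) N))"
      using True by (subst card_Gr_image[OF R'(1)]) (simp_all add: dims d_def)
    also have "\<dots> = gauss_binom ?q (l - e + 1) a * gauss_binom ?q (l - a) e" using True N[of "l - e"] by simp
    also have "\<dots> = gauss_binom ?q (l - a) e * gauss_binom ?q (a + 1 + (l - a - e)) a"
    proof (cases "e \<le> l - a")
      case True
      then have "a + 1 + (l - a - e) = l - e + 1" using a by simp
      then show ?thesis by simp
    next
      case False
      then show ?thesis using q by simp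
    qed
    also have "\<dots> = (\<Sum>j\<le>a. w j * gauss_binom ?q (l - a - j) e)"
      unfolding w_def gauss_binom_sum_trinomial_high[OF q] ..
    finally show ?thesis .
  next
    case False
    then show ?thesis using q by simp
  qed
  \<comment> \<open>The double subtraction expresses the dimension of the preimage by the codimension \<open>l - d U\<close>,
      whose moments are known.\<close>
  have "real (card (Gr (c, a) M)) = (\<Sum>U\<in>subspaces (l + 1) a. gauss_binom ?q (2 * a - (l - (l - d U))) c)"
    unfolding card_Gr_preimage[OF R'(2)] R'(3) dims
  proof (rule sum.cong[OF refl])
    fix U :: "'k vec set" assume "U \<in> subspaces (l + 1) a"
    then have "2 * a - (l - (l - d U)) = subspace_dim (dim1 M) (arrow_preimage M U)"
      using dim[of U] by linarith
    then show "gauss_binom ?q (subspace_dim (dim1 M) (arrow_preimage M U)) c = gauss_binom ?q (2 * a - (l - (l - d U))) c"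
      by simp
  qed
  also have "\<dots> = (\<Sum>j\<le>a. w j * gauss_binom ?q (2 * a - (l - (l - a - j))) c)"
    by (rule gauss_binom_moments_determine[OF q moments, where N = l]) auto
  also have "\<dots> = (\<Sum>j\<le>a. w j * gauss_binom ?q (a - j) c)"
  proof (rule sum.cong[OF refl])
    fix j assume "j \<in> {..a}"
    show "w j * gauss_binom ?q (2 * a - (l - (l - a - j))) c = w j * gauss_binom ?q (a - j) c"
    proof (cases "j \<le> l - a")
      case True
      then have "2 * a - (l - (l - a - j)) = a - j" using a by simp
      then show ?thesis by simp
    next
      case False
      then show ?thesis using q by (simp add: w_def)
    qed
  qed
  also have "\<dots> = gauss_binom ?q (a + 1) c * gauss_binom ?q (l + 1 - c) (l + 1 - a)"
  proof (cases "c \<le> a")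
    case True
    then have "gauss_binom ?q (l + 1 - c) (l + 1 - a) = gauss_binom ?q (l + 1 - c) (a - c)"
      using gauss_binom_symmetric[OF q, of "a - c" "l + 1 - c"] a by simp
    then show ?thesis
      unfolding w_def gauss_binom_sum_trinomial_low[OF q] using True a by simp
  next
    case False
    then show ?thesis unfolding w_def gauss_binom_sum_trinomial_low[OF q] using a q by simp
  qed
  finally show ?thesis .
qed

text \<open>The subtraction \<open>b - 1\<close> is truncated for \<open>b = 0\<close>, where the formula correctly yields \<open>1\<close> for \<open>a = 0\<close>
  and \<open>0\<close> otherwise.\<close>

proposition card_Gr_preprojective:
  fixes M :: "'k::{field,finite} kmod"
  assumes "preprojective M" "dimvec M = (l, l + 1)" "b \<le> l + 1"
  shows "real (card (Gr (a, b) M)) =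
    gauss_binom (CARD('k)) (l + 1 - a) (l + 1 - b) * gauss_binom (CARD('k)) (b - 1) a"
  using assms
proof (induction l arbitrary: M a b rule: less_induct)
  case (less l)
  let ?q = "real CARD('k)"
  have q: "?q > 1" using field_order_gt_1[where 'k = 'k] by simp
  have dims: "dim1 M = l" "dim2 M = l + 1" using less.prems(2) by (simp_all add: dimvec_def)
  obtain N where R: "sink_reflection M N" and N: "preprojective N"
    using less.prems(1) dims by (cases rule: preprojective.cases) (auto simp: dimvec_def)
  note R' = sink_reflectionD[OF R]
  consider "a = 0" | "a > l" | "1 \<le> a" "a \<le> l" by linarith
  then show ?case
  proof cases
    case 1
    have "fst M *\<^sub>v 0\<^sub>v l = 0\<^sub>v (l + 1)" "snd M *\<^sub>v 0\<^sub>v l = 0\<^sub>v (l + 1)"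
      using kmod_carrier[OF R'(1)] dims by (auto intro!: eq_vecI)
    then have "arrow_image M {0\<^sub>v l} = {0\<^sub>v (l + 1)}"
      by (simp add: arrow_image_def arrow_sum_def)
    moreover have "subspace_dim (l + 1) {0\<^sub>v (l + 1) :: 'k vec} = 0"
      by (simp add: subspace_dim_eq_iff lin_subspace_zero)
    ultimately show ?thesis
      using 1 less.prems(3) q card_Gr_image[OF R'(1), of b a] by (simp add: dims subspaces_0)
  next
    case 2
    then show ?thesis
      using less.prems(3) q card_Gr_image[OF R'(1), of b a] by (simp add: dims subspaces_empty)
  next
    case 3
    then obtain l' where l: "l = Suc l'" by (cases l) auto
    have "subspace_dim (dim2 M) (arrow_image M (carrier_vec (dim1 M))) \<le> dim2 M"
      using dim_arrow_image_le[OF R'(1) lin_subspace_carrier] .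
    then have "dimvec N = (l', l' + 1)"
      using sink_reflection_dim1[OF R] R'(3) preprojective_defect[OF N] dims l
      by (auto simp: dimvec_def)
    then have "real (card (Gr (c, a) N)) = gauss_binom ?q (l - c) (l - a) * gauss_binom ?q (a - 1) c" for c
      using less.IH[of l' N a c] N 3 l by simp
    then show ?thesis
      using card_Gr_step_preprojective[OF R dims 3 less.prems(3)] by simp
  qed
qed

proposition card_Gr_preinjective:
  fixes M :: "'k::{field,finite} kmod"
  assumes "preinjective M" "dimvec M = (l + 1, l)" "b \<le> l"
  shows "real (card (Gr (a, b) M)) =
    gauss_binom (CARD('k)) (b + 1) a * gauss_binom (CARD('k)) (l - a) (l - b)"
  using assms
proof (induction l arbitrary: M a b rule: less_induct)
  case (less l)
  let ?q = "real CARD('k)"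
  have q: "?q > 1" using field_order_gt_1[where 'k = 'k] by simp
  have dims: "dim1 M = l + 1" "dim2 M = l" using less.prems(2) by (simp_all add: dimvec_def)
  obtain N where R: "source_reflection M N" and N: "preinjective N"
    using less.prems(1) dims by (cases rule: preinjective.cases) (auto simp: dimvec_def)
  note R' = source_reflectionD[OF R]
  show ?case
  proof (cases "b = l")
    case True
    then show ?thesis
      using q card_Gr_preimage[OF R'(1), of a b] arrow_preimage_carrier[OF R'(1)]
      by (simp add: dims subspaces_full subspace_dim_carrier)
  next
    case False
    then have "b < l" using less.prems(3) by simp
    then obtain l' where l: "l = Suc l'" "b \<le> l'" by (cases l) auto
    have N_dims: "dim1 N = l' + 1" "dim2 N = l'"
      using source_reflection_dim1[OF R] R'(3) preinjective_defect[OF N] dims l(1) by linarith+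
    have S: "sink_reflection N M"
      by (rule sink_reflection_of_source_reflection[OF R]) (simp add: dims N_dims l(1))
    have "real (card (Gr (b, c) N)) = gauss_binom ?q (c + 1) b * gauss_binom ?q (l' - b) (l' - c)" if "c \<le> l'" for c
      using less.IH[of l' N c b] N N_dims that l by (simp add: dimvec_def)
    then show ?thesis
      using card_Gr_step_preinjective[OF S N_dims l(2), of a] l(1) by simp
  qed
qed

section \<open>A linear recurrence for the quantum cluster characters\<close>

text \<open>Integer arguments, with value zero outside \<open>0 \<le> k \<le> n\<close>, make sums over all of the lattice possible.
  The price is a correction term in the Pascal identity at \<open>n = k = 0\<close>.\<close>

definition gauss_binom_int :: "real \<Rightarrow> int \<Rightarrow> int \<Rightarrow> real" where
  "gauss_binom_int q n k = (if 0 \<le> k \<and> k \<le> n then gauss_binom q (nat n) (nat k) else 0)"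

lemma gauss_binom_int_Pascal:
  assumes q: "q > 1"
  shows "gauss_binom_int q n k = gauss_binom_int q (n - 1) k + q powi (n - k) * gauss_binom_int q (n - 1) (k - 1)
    + (if n = 0 \<and> k = 0 then 1 else 0)"
proof -
  consider "k < 0 \<or> n < k" | "k = 0" "0 \<le> n" | "1 \<le> k" "k \<le> n" by linarith
  then show ?thesis
  proof cases
    case 3
    define n' k' where "n' = nat (n - 1)" and "k' = nat (k - 1)"
    have n: "n = int (Suc n')" and k: "k = int (Suc k')" and le: "k' \<le> n'"
      using 3 by (simp_all add: n'_def k'_def)
    have "q powi (n - k) = q ^ (n' - k')"
      using le by (simp add: n k power_int_def nat_diff_distrib')
    moreover have "gauss_binom_int q n k = gauss_binom q (Suc n') (Suc k')"
      using le by (simp add: gauss_binom_int_def n k nat_add_distrib)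
    moreover have "gauss_binom_int q (n - 1) (k - 1) = gauss_binom q n' k'"
      using le by (simp add: gauss_binom_int_def n k)
    moreover have "gauss_binom_int q (n - 1) k = gauss_binom q n' (Suc k')"
      using le q by (auto simp add: gauss_binom_int_def n k nat_add_distrib)
    ultimately show ?thesis
      using 3 gauss_binom_Pascal[OF q le] by simp
  qed (auto simp: gauss_binom_int_def gauss_binom_0[OF q])
qed

text \<open>The cardinalities of \<open>Gr (a, b)\<close> for the modules \<open>V(-l)\<close> and \<open>V(l + 3)\<close>. The correction terms
  account for the submodule \<open>0\<close> and the whole module, respectively. The formulas make sense for
  \<open>l = -1\<close> and \<open>l = -2\<close>, where only the correction term survives and describes a monomial.\<close>

definition preproj_weight :: "real \<Rightarrow> int \<Rightarrow> int \<Rightarrow> int \<Rightarrow> real" where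
  "preproj_weight q l a b =
    gauss_binom_int q (l + 1 - a) (b - a) * gauss_binom_int q (b - 1) a + (if a = 0 \<and> b = 0 then 1 else 0)"

definition preinj_weight :: "real \<Rightarrow> int \<Rightarrow> int \<Rightarrow> int \<Rightarrow> real" where
  "preinj_weight q l a b =
    gauss_binom_int q (l - a) (b - a) * gauss_binom_int q (b + 1) a + (if a = l + 1 \<and> b = l then 1 else 0)"

text \<open>One Pascal identity for each of the two factors \<open>A\<close> and \<open>B\<close> of the weight: the two ways of expanding
  \<open>(A - A0) * (B - t * B1)\<close> are the two sides.\<close>

lemma preproj_weight_recurrence:
  assumes q: "q > 1" and l: "l \<ge> -1"
  shows "preproj_weight q (l + 1) a b + q powi (b - a - 1) * preproj_weight q (l - 1) (a - 1) (b - 1) =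
    preproj_weight q l a b + q powi (l + 2 - b) * preproj_weight q l a (b - 1)
      + q powi (b - a - 1) * preproj_weight q l (a - 1) (b - 1)"
proof -
  define A A0 A1 B B0 B1 dA dB r t where
    "A = gauss_binom_int q (l + 2 - a) (b - a)" "A0 = gauss_binom_int q (l + 1 - a) (b - a)"
    "A1 = gauss_binom_int q (l + 1 - a) (b - 1 - a)" "B = gauss_binom_int q (b - 1) a"
    "B0 = gauss_binom_int q (b - 2) a" "B1 = gauss_binom_int q (b - 2) (a - 1)"
    "dA = (if l + 2 - a = 0 \<and> b - a = 0 then 1 else (0::real))"
    "dB = (if b - 1 = 0 \<and> a = 0 then 1 else (0::real))"
    "r = q powi (l + 2 - b)" "t = q powi (b - a - 1)"
  note defs = this
  have A: "A = A0 + r * A1 + dA"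
    using gauss_binom_int_Pascal[OF q, of "l + 2 - a" "b - a"] by (simp add: defs algebra_simps)
  have B: "B = B0 + t * B1 + dB"
    using gauss_binom_int_Pascal[OF q, of "b - 1" a] by (simp add: defs algebra_simps)
  \<comment> \<open>The corrections in the Pascal identities make up for those in the weights.\<close>
  have corner: "r * A1 * dB = r * dB" "dA * B0 = 0" "dA * dB = 0"
    using l by (auto simp: defs gauss_binom_int_def gauss_binom_0[OF q])
  have w: "preproj_weight q (l + 1) a b = A * B + (if a = 0 \<and> b = 0 then 1 else 0)"
    "preproj_weight q (l - 1) (a - 1) (b - 1) = A0 * B1 + (if a = 1 \<and> b = 1 then 1 else 0)"
    "preproj_weight q l a b = A0 * B + (if a = 0 \<and> b = 0 then 1 else 0)"
    "preproj_weight q l a (b - 1) = A1 * B0 + dB"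
    "preproj_weight q l (a - 1) (b - 1) = A * B1 + (if a = 1 \<and> b = 1 then 1 else 0)"
    by (simp_all add: preproj_weight_def defs algebra_simps)
  have "A * B + t * (A0 * B1) = A0 * B + r * (A1 * B0) + t * (A * B1) + r * dB"
  proof -
    have "A * B + t * (A0 * B1) - (A0 * B + r * (A1 * B0) + t * (A * B1)) =
        (A - A0) * (B - t * B1) - r * A1 * B0"
      by (simp add: algebra_simps)
    also have "\<dots> = (r * A1 + dA) * (B0 + dB) - r * A1 * B0"
      by (simp add: A B)
    also have "\<dots> = r * A1 * dB + dA * B0 + dA * dB"
      by (simp add: algebra_simps)
    also have "\<dots> = r * dB"
      unfolding corner by simp
    finally show ?thesis by simp
  qed
  then show ?thesis
    unfolding w defs(9,10)[symmetric] by (simp add: algebra_simps)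
qed

lemma preinj_weight_recurrence:
  assumes q: "q > 1" and l: "l \<ge> -1"
  shows "preinj_weight q (l + 1) a b + q powi (b - a + 1) * preinj_weight q (l - 1) (a - 1) (b - 1) =
    preinj_weight q l a b + q powi (l + 1 - b) * preinj_weight q l a (b - 1)
      + q powi (b - a + 1) * preinj_weight q l (a - 1) (b - 1)"
proof -
  define A A0 A1 B B0 B1 dA dB r t where
    "A = gauss_binom_int q (l + 1 - a) (b - a)" "A0 = gauss_binom_int q (l - a) (b - a)"
    "A1 = gauss_binom_int q (l - a) (b - 1 - a)" "B = gauss_binom_int q (b + 1) a"
    "B0 = gauss_binom_int q b a" "B1 = gauss_binom_int q b (a - 1)"
    "dA = (if l + 1 - a = 0 \<and> b - a = 0 then 1 else (0::real))"
    "dB = (if b + 1 = 0 \<and> a = 0 then 1 else (0::real))"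
    "r = q powi (l + 1 - b)" "t = q powi (b - a + 1)"
  note defs = this
  have A: "A = A0 + r * A1 + dA"
    using gauss_binom_int_Pascal[OF q, of "l + 1 - a" "b - a"] by (simp add: defs algebra_simps)
  have B: "B = B0 + t * B1 + dB"
    using gauss_binom_int_Pascal[OF q, of "b + 1" a] by (simp add: defs algebra_simps)
  \<comment> \<open>The corrections in the Pascal identities make up for those in the weights.\<close>
  have corner: "r * A1 * dB = 0" "dA * B0 = r * dA" "dA * dB = 0"
    using l by (auto simp: defs gauss_binom_int_def gauss_binom_diag[OF q])
  have w: "preinj_weight q (l + 1) a b = A * B + (if a = l + 2 \<and> b = l + 1 then 1 else 0)"
    "preinj_weight q (l - 1) (a - 1) (b - 1) = A0 * B1 + (if a = l + 1 \<and> b = l then 1 else 0)"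
    "preinj_weight q l a b = A0 * B + (if a = l + 1 \<and> b = l then 1 else 0)"
    "preinj_weight q l a (b - 1) = A1 * B0 + dA"
    "preinj_weight q l (a - 1) (b - 1) = A * B1 + (if a = l + 2 \<and> b = l + 1 then 1 else 0)"
    by (auto simp: preinj_weight_def defs algebra_simps)
  have t1: "t * (if a = l + 1 \<and> b = l then 1 else 0) = (if a = l + 1 \<and> b = l then 1 else 0)"
    "t * (if a = l + 2 \<and> b = l + 1 then 1 else 0) = (if a = l + 2 \<and> b = l + 1 then 1 else 0)"
    by (auto simp: defs)
  have "A * B + t * (A0 * B1) = A0 * B + r * (A1 * B0) + t * (A * B1) + r * dA"
  proof -
    have "A * B + t * (A0 * B1) - (A0 * B + r * (A1 * B0) + t * (A * B1)) =
        (A - A0) * (B - t * B1) - r * A1 * B0"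
      by (simp add: algebra_simps)
    also have "\<dots> = (r * A1 + dA) * (B0 + dB) - r * A1 * B0"
      by (simp add: A B)
    also have "\<dots> = r * A1 * dB + dA * B0 + dA * dB"
      by (simp add: algebra_simps)
    also have "\<dots> = r * dA"
      unfolding corner by simp
    finally show ?thesis by simp
  qed
  then show ?thesis
    unfolding w defs(9,10)[symmetric] distrib_left t1 by (simp add: algebra_simps)
qed

lemma coef_eqI: "(\<And>e. coef x e = coef y e) \<Longrightarrow> x = y"
  using coef_inject by blast

lemma coef_add [simp]: "coef (x + y) e = coef x e + coef y e"
  by transfer simp

lemma coef_diff [simp]: "coef (x - y) e = coef x e - coef y e"
  by transfer simp

lemma coef_zero [simp]: "coef 0 e = 0"
  by transfer simp

lemma coef_sum: "coef (sum f A) e = (\<Sum>i\<in>A. coef (f i) e)"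
  by (induction A rule: infinite_finite_induct) simp_all

lemma coef_X: "coef (X f) e = (if e = f then 1 else 0)"
  by transfer simp

lemma Lam_self [simp]: "Lam a a = 0"
  by (cases a) simp

lemma coef_X_mult: "coef (X d * z :: 'k::finite qtorus) e = sqrt_q TYPE('k) powi Lam d e * coef z (e - d)"
proof transfer
  fix d e and f :: "lat \<Rightarrow> real"
  have "Lam d (e - d) = Lam d e"
    using Lam_add_right[of d "e - d" d] by simp
  then show "conv (sqrt_q TYPE('k)) (\<lambda>c. if c = d then 1 else 0) f e =
      sqrt_q TYPE('k) powi Lam d e * f (e - d)"
    by (simp add: conv_superset[of "{d}"])
qed

lemma coef_qh_mult: "coef (qh i * z :: 'k::finite qtorus) e = sqrt_q TYPE('k) powi i * coef z e"
proof transfer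
  fix i e and f :: "lat \<Rightarrow> real"
  show "conv (sqrt_q TYPE('k)) (\<lambda>c. if c = 0 then sqrt_q TYPE('k) powi i else 0) f e =
      sqrt_q TYPE('k) powi i * f e"
    by (subst conv_superset[of "{0}"]) auto
qed

lemma coef_of_nat_mult: "coef (of_nat n * z) e = of_nat n * coef z e"
  by (induction n) (simp_all add: algebra_simps)

text \<open>The shape of a quantum cluster character with dimension vector \<open>(m1, m2)\<close>, with the cardinality of
  \<open>Gr (a, b)\<close> replaced by an arbitrary number \<open>g a b\<close>. The exponents in the third and fourth place
  determine \<open>(a, b)\<close>, so those in the first two places are functions of them. The dimensions may be
  negative: this covers the initial cluster variables.\<close>

definition has_expansion ::
    "'k::{field,finite} qtorus \<Rightarrow> int \<Rightarrow> int \<Rightarrow> (int \<Rightarrow> int \<Rightarrow> real) \<Rightarrow> bool" where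
  "has_expansion z m1 m2 g \<longleftrightarrow> (\<forall>e1 e2 e3 e4. coef z (e1, e2, e3, e4) =
    (if e1 = 2 * e4 - m1 \<and> e2 = 2 * (m1 - e3) - m2
     then sqrt_q TYPE('k) powi (- euler (m1 - e3, m2 - e4) (e3, e4)) * g (m1 - e3) (m2 - e4) else 0))"

lemma has_expansion_X:
  assumes "\<And>a b. g a b = (if a = a0 \<and> b = b0 then 1 else 0)"
    and "euler (a0, b0) (m1 - a0, m2 - b0) = 0"
  shows "has_expansion (X (2 * (m2 - b0) - m1, 2 * a0 - m2, m1 - a0, m2 - b0)) m1 m2 g"
  using assms unfolding has_expansion_def by (auto simp: coef_X)

text \<open>Each of the three monomials of \<open>Xdelta\<close> shifts the lattice; comparing coefficients turns the
  recurrence for the characters into one for the numbers \<open>g a b\<close>.\<close>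

lemma has_expansion_recurrence:
  fixes z0 z1 z2 :: "'k::{field,finite} qtorus"
  assumes z0: "has_expansion z0 (m1 - 1) (m2 - 1) g0"
    and z1: "has_expansion z1 m1 m2 g1"
    and z2: "has_expansion z2 (m1 + 1) (m2 + 1) g2"
    and rec: "\<And>a b. g2 a b + CARD('k) powi (b - a + (m1 - m2)) * g0 (a - 1) (b - 1) =
      g1 a b + CARD('k) powi (m2 + 1 - b) * g1 a (b - 1)
        + CARD('k) powi (b - a + (m1 - m2)) * g1 (a - 1) (b - 1)"
  shows "z2 = Xdelta * z1 - X (0, 0, 1, 1) * z0"
proof (rule coef_eqI)
  fix e :: lat
  obtain e1 e2 e3 e4 where e: "e = (e1, e2, e3, e4)" by (metis prod_cases4)
  let ?s = "sqrt_q TYPE('k)"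
  have s: "?s \<noteq> 0" using sqrt_q_pos[where 'a = 'k] by (simp add: less_le)
  have s2: "real CARD('k) powi n = ?s powi (2 * n)" for n
    by (simp add: power_int_mult sqrt_q_def)
  have diffs: "(e1, e2, e3, e4) - (1, -1, 1, 1) = (e1 - 1, e2 + 1, e3 - 1, e4 - 1)"
    "(e1, e2, e3, e4) - (-1, -1, 1, 0) = (e1 + 1, e2 + 1, e3 - 1, e4)"
    "(e1, e2, e3, e4) - (-1, 1, 0, 0) = (e1 + 1, e2 - 1, e3, e4)"
    "(e1, e2, e3, e4) - (0, 0, 1, 1) = (e1, e2, e3 - 1, e4 - 1)"
    by simp_all
  have "coef (Xdelta * z1 - X (0, 0, 1, 1) * z0) e =
      ?s powi Lam (1, -1, 1, 1) e * coef z1 (e1 - 1, e2 + 1, e3 - 1, e4 - 1)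
      + ?s powi Lam (-1, -1, 1, 0) e * coef z1 (e1 + 1, e2 + 1, e3 - 1, e4)
      + ?s powi Lam (-1, 1, 0, 0) e * coef z1 (e1 + 1, e2 - 1, e3, e4)
      - ?s powi Lam (0, 0, 1, 1) e * coef z0 (e1, e2, e3 - 1, e4 - 1)"
    unfolding Xdelta_def distrib_right coef_diff coef_add coef_X_mult e diffs ..
  also have "\<dots> = coef z2 e"
  proof (cases "e1 = 2 * e4 - (m1 + 1) \<and> e2 = 2 * (m1 + 1 - e3) - (m2 + 1)")
    case False
    then show ?thesis
      using z0 z1 z2 unfolding has_expansion_def e by auto
  next
    case True
    define a b where "a = m1 + 1 - e3" and "b = m2 + 1 - e4"
    have e3: "e3 = m1 + 1 - a" and e4: "e4 = m2 + 1 - b"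
      and e1: "e1 = 2 * e4 - (m1 + 1)" and e2: "e2 = 2 * a - (m2 + 1)"
      using True by (simp_all add: a_def b_def)
    define E where "E = - euler (a, b) (m1 + 1 - a, m2 + 1 - b)"
    have c1: "coef z1 (e1 - 1, e2 + 1, e3 - 1, e4 - 1) = ?s powi (- euler (a, b) (m1 - a, m2 - b)) * g1 a b"
      using z1 unfolding has_expansion_def e1 e2 e3 e4 by (simp add: algebra_simps)
    have c2: "coef z1 (e1 + 1, e2 + 1, e3 - 1, e4) =
        ?s powi (- euler (a, b - 1) (m1 - a, m2 + 1 - b)) * g1 a (b - 1)"
      using z1 unfolding has_expansion_def e1 e2 e3 e4 by (simp add: algebra_simps)
    have c3: "coef z1 (e1 + 1, e2 - 1, e3, e4) =
        ?s powi (- euler (a - 1, b - 1) (m1 + 1 - a, m2 + 1 - b)) * g1 (a - 1) (b - 1)"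
      using z1 unfolding has_expansion_def e1 e2 e3 e4 by (simp add: algebra_simps)
    have c0: "coef z0 (e1, e2, e3 - 1, e4 - 1) =
        ?s powi (- euler (a - 1, b - 1) (m1 - a, m2 - b)) * g0 (a - 1) (b - 1)"
      using z0 unfolding has_expansion_def e1 e2 e3 e4 by (simp add: algebra_simps)
    have c: "coef z2 e = ?s powi E * g2 a b"
      using z2 unfolding has_expansion_def e e1 e2 e3 e4 E_def by simp
    have E1: "Lam (1, -1, 1, 1) e + - euler (a, b) (m1 - a, m2 - b) = E"
      by (simp add: e e1 e2 e3 e4 E_def algebra_simps)
    have E2: "Lam (-1, -1, 1, 0) e + - euler (a, b - 1) (m1 - a, m2 + 1 - b) = E + 2 * (m2 + 1 - b)"
      by (simp add: e e1 e2 e3 e4 E_def algebra_simps)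
    have E3: "Lam (-1, 1, 0, 0) e + - euler (a - 1, b - 1) (m1 + 1 - a, m2 + 1 - b) = E + 2 * (b - a + (m1 - m2))"
      by (simp add: e e1 e2 e3 e4 E_def algebra_simps)
    have E0: "Lam (0, 0, 1, 1) e + - euler (a - 1, b - 1) (m1 - a, m2 - b) = E + 2 * (b - a + (m1 - m2))"
      by (simp add: e e1 e2 e3 e4 E_def algebra_simps)
    have "?s powi E * (g1 a b + ?s powi (2 * (m2 + 1 - b)) * g1 a (b - 1)
          + ?s powi (2 * (b - a + (m1 - m2))) * g1 (a - 1) (b - 1)
          - ?s powi (2 * (b - a + (m1 - m2))) * g0 (a - 1) (b - 1)) = ?s powi E * g2 a b"
      unfolding s2[symmetric] rec[symmetric] by simp
    then show ?thesis
      unfolding c c0 c1 c2 c3 mult.assoc[symmetric] power_int_add[OF disjI1[OF s], symmetric] E0 E1 E2 E3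
      unfolding power_int_add[OF disjI1[OF s]] by (simp add: algebra_simps)
  qed
  finally show "coef z2 e = coef (Xdelta * z1 - X (0, 0, 1, 1) * z0) e" ..
qed

lemma has_expansion_XM:
  fixes M :: "'k::{field,finite} kmod"
  assumes g: "\<And>a b. g a b = (if 0 \<le> a \<and> a \<le> int (dim1 M) \<and> 0 \<le> b \<and> b \<le> int (dim2 M)
    then real (card (Gr (nat a, nat b) M)) else 0)"
  shows "has_expansion (XM M) (int (dim1 M)) (int (dim2 M)) g"
  unfolding has_expansion_def
proof (intro allI)
  fix e1 e2 e3 e4 :: int
  define m1 m2 where "m1 = int (dim1 M)" and "m2 = int (dim2 M)"
  let ?s = "sqrt_q TYPE('k)"
  let ?G = "{0..dim1 M} \<times> {0..dim2 M}"
  let ?t = "\<lambda>(a, b). if e1 = 2 * m2 - m1 - 2 * int b \<and> e2 = 2 * int a - m2 \<and> e3 = m1 - int a \<and> e4 = m2 - int b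
      then real (card (Gr (a, b) M)) * ?s powi (- euler (int a, int b) (m1 - int a, m2 - int b)) else 0"
  have "coef (XM M) (e1, e2, e3, e4) = (\<Sum>p\<in>?G. ?t p)"
    unfolding XM_def Let_def coef_sum m1_def[symmetric] m2_def[symmetric]
    by (rule sum.cong) (auto simp: mult.assoc coef_of_nat_mult coef_qh_mult coef_X)
  also have "\<dots> = (if e1 = 2 * e4 - m1 \<and> e2 = 2 * (m1 - e3) - m2
     then ?s powi (- euler (m1 - e3, m2 - e4) (e3, e4)) * g (m1 - e3) (m2 - e4) else 0)"
  proof (cases "e1 = 2 * e4 - m1 \<and> e2 = 2 * (m1 - e3) - m2 \<and>
      0 \<le> m1 - e3 \<and> m1 - e3 \<le> m1 \<and> 0 \<le> m2 - e4 \<and> m2 - e4 \<le> m2")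
    case False
    then have "?t p = 0" if "p \<in> ?G" for p
      using that by (auto simp: m1_def m2_def)
    then have "(\<Sum>p\<in>?G. ?t p) = 0" by (rule sum.neutral[OF ballI])
    then show ?thesis using False by (auto simp: g m1_def m2_def)
  next
    case True
    define a b where "a = nat (m1 - e3)" and "b = nat (m2 - e4)"
    have ab: "int a = m1 - e3" "int b = m2 - e4" "(a, b) \<in> ?G"
      using True by (auto simp: a_def b_def m1_def m2_def)
    have "(\<Sum>p\<in>?G. ?t p) = (\<Sum>p\<in>{(a, b)}. ?t p)"
      by (rule sum.mono_neutral_right) (use ab in \<open>auto split: if_splits\<close>)
    then show ?thesis
      using True ab by (simp add: g m1_def[symmetric] m2_def[symmetric] a_def[symmetric] b_def[symmetric] mult.commute)
  qed
  finally show "coef (XM M) (e1, e2, e3, e4) = (if e1 = 2 * e4 - int (dim1 M) \<and> e2 = 2 * (int (dim1 M) - e3) - int (dim2 M)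
     then ?s powi (- euler (int (dim1 M) - e3, int (dim2 M) - e4) (e3, e4)) * g (int (dim1 M) - e3) (int (dim2 M) - e4) else 0)"
    unfolding m1_def m2_def .
qed

lemma preproj_expansion:
  fixes M :: "'k::{field,finite} kmod"
  assumes M: "preprojective M" "dimvec M = (l, l + 1)"
  shows "has_expansion (XM M) (int l) (int l + 1) (preproj_weight (CARD('k)) (int l))"
proof -
  let ?q = "real CARD('k)"
  have q: "?q > 1" using field_order_gt_1[where 'k = 'k] by simp
  have dims: "dim1 M = l" "dim2 M = l + 1" using M(2) by (simp_all add: dimvec_def)
  have "preproj_weight ?q (int l) a b = (if 0 \<le> a \<and> a \<le> int (dim1 M) \<and> 0 \<le> b \<and> b \<le> int (dim2 M)
    then real (card (Gr (nat a, nat b) M)) else 0)" for a b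
  proof (cases "0 \<le> a \<and> a \<le> int l \<and> 0 \<le> b \<and> b \<le> int l + 1")
    case False
    then show ?thesis
      using q by (auto simp: dims preproj_weight_def gauss_binom_int_def)
  next
    case True
    then obtain a' b' where ab: "a = int a'" "b = int b'" "a' \<le> l" "b' \<le> l + 1"
      by (metis int_ops(2) nat_int_comparison(3) nonneg_int_cases of_nat_add)
    have "real (card (Gr (a', b') M)) = gauss_binom ?q (l + 1 - a') (l + 1 - b') * gauss_binom ?q (b' - 1) a'"
      by (rule card_Gr_preprojective[OF M ab(4)])
    also have "\<dots> = preproj_weight ?q (int l) a b"
    proof (cases "a' \<le> b' \<and> b' > 0")
      case True
      then have "nat (int l + 1 - a) = l + 1 - a'" "nat (b - a) = b' - a'" "nat (b - 1) = b' - 1"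
        using ab by auto
      moreover have "gauss_binom ?q (l + 1 - a') (l + 1 - b') = gauss_binom ?q (l + 1 - a') (b' - a')"
        using gauss_binom_symmetric[OF q, of "b' - a'" "l + 1 - a'"] True ab by simp
      ultimately show ?thesis
        using True ab q by (auto simp: preproj_weight_def gauss_binom_int_def)
    next
      case False
      then show ?thesis
        using ab q by (cases "b' = 0"; cases "a' = 0") (auto simp: preproj_weight_def gauss_binom_int_def)
    qed
    finally show ?thesis using ab by (simp add: dims)
  qed
  from has_expansion_XM[of "preproj_weight ?q (int l)" M, OF this] show ?thesis
    by (simp add: dims add.commute)
qed

lemma preinj_expansion:
  fixes M :: "'k::{field,finite} kmod"
  assumes M: "preinjective M" "dimvec M = (l + 1, l)"
  shows "has_expansion (XM M) (int l + 1) (int l) (preinj_weight (CARD('k)) (int l))"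
proof -
  let ?q = "real CARD('k)"
  have q: "?q > 1" using field_order_gt_1[where 'k = 'k] by simp
  have dims: "dim1 M = l + 1" "dim2 M = l" using M(2) by (simp_all add: dimvec_def)
  have "preinj_weight ?q (int l) a b = (if 0 \<le> a \<and> a \<le> int (dim1 M) \<and> 0 \<le> b \<and> b \<le> int (dim2 M)
    then real (card (Gr (nat a, nat b) M)) else 0)" for a b
  proof (cases "0 \<le> a \<and> a \<le> int l + 1 \<and> 0 \<le> b \<and> b \<le> int l")
    case False
    then show ?thesis
      using q by (auto simp: dims preinj_weight_def gauss_binom_int_def)
  next
    case True
    then obtain a' b' where ab: "a = int a'" "b = int b'" "a' \<le> l + 1" "b' \<le> l"
      by (metis int_ops(2) nat_int_comparison(3) nonneg_int_cases of_nat_add)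
    have "real (card (Gr (a', b') M)) = gauss_binom ?q (b' + 1) a' * gauss_binom ?q (l - a') (l - b')"
      by (rule card_Gr_preinjective[OF M ab(4)])
    also have "\<dots> = preinj_weight ?q (int l) a b"
    proof (cases "a' \<le> b'")
      case True
      then have "nat (int l - a) = l - a'" "nat (b - a) = b' - a'" "nat (b + 1) = b' + 1"
        using ab by auto
      moreover have "gauss_binom ?q (l - a') (l - b') = gauss_binom ?q (l - a') (b' - a')"
        using gauss_binom_symmetric[OF q, of "b' - a'" "l - a'"] True ab by simp
      ultimately show ?thesis
        using True ab q by (auto simp: preinj_weight_def gauss_binom_int_def)
    next
      case False
      then consider "a' = b' + 1" "b' = l" | "a' = b' + 1" "b' < l" | "a' > b' + 1"
        using ab by linarith
      then show ?thesis
        using ab q by cases (auto simp: preinj_weight_def gauss_binom_int_def)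
    qed
    finally show ?thesis using ab by (simp add: dims)
  qed
  from has_expansion_XM[of "preinj_weight ?q (int l)" M, OF this] show ?thesis
    by (simp add: dims add.commute)
qed

section \<open>Calculating in the quantum torus\<close>

lemma coef_mult_qh: "coef (z * qh i :: 'k::finite qtorus) e = sqrt_q TYPE('k) powi i * coef z e"
proof transfer
  fix i e and f :: "lat \<Rightarrow> real"
  assume f: "finite {e. f e \<noteq> 0} \<and> (\<forall>e. f e \<in> Zq TYPE('k))"
  let ?s = "sqrt_q TYPE('k)"
  have "conv ?s f (\<lambda>c. if c = 0 then ?s powi i else 0) e =
      (\<Sum>a\<in>insert e {e. f e \<noteq> 0}. ?s powi Lam a (e - a) * f a * (if e - a = 0 then ?s powi i else 0))"
    by (rule conv_superset) (use f in auto)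
  also have "\<dots> = (\<Sum>a\<in>insert e {e. f e \<noteq> 0}. if a = e then ?s powi i * f e else 0)"
    by (rule sum.cong) auto
  also have "\<dots> = ?s powi i * f e" using f by simp
  finally show "conv ?s f (\<lambda>c. if c = 0 then ?s powi i else 0) e = ?s powi i * f e" .
qed

lemma qh_central: "z * qh i = qh i * z"
  by (rule coef_eqI) (simp add: coef_qh_mult coef_mult_qh)

lemma qh_0: "qh 0 = 1"
  by transfer auto

lemma coef_qh: "coef (qh i :: 'k::finite qtorus) e = (if e = 0 then sqrt_q TYPE('k) powi i else 0)"
  by transfer simp

lemma qh_mult: "qh i * qh j = (qh (i + j) :: 'k::finite qtorus)"
proof (rule coef_eqI)
  fix e
  have "sqrt_q TYPE('k) \<noteq> 0" using sqrt_q_pos[where 'a = 'k] by (simp add: less_le)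
  then show "coef (qh i * qh j :: 'k qtorus) e = coef (qh (i + j) :: 'k qtorus) e"
    by (simp add: coef_qh_mult coef_qh power_int_add)
qed

lemma X_0: "X (0, 0, 0, 0) = 1"
  by transfer (auto simp: zero_prod_def)

lemma qh_mult_left: "qh i * (qh j * z) = qh (i + j) * z"
  by (simp add: qh_mult flip: mult.assoc)

lemma qh_left_commute: "z * (qh i * w) = qh i * (z * w)"
  by (simp add: qh_central[of z] flip: mult.assoc)

lemma X_mult_left: "X e * (X f * z) = qh (Lam e f) * (X (e + f) * z)"
  by (simp add: X_mult flip: mult.assoc)

lemmas monomial_simps = X_mult X_mult_left qh_mult qh_mult_left
  qh_central[of "X e" for e] qh_left_commute[of "X e" for e] qh_0 X_0

abbreviation (input) Y :: "'k::finite qtorus" where "Y \<equiv> X (0, 0, 1, 1)"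

lemma Xdelta_Y: "Xdelta * Y = Y * Xdelta"
  by (simp add: Xdelta_def distrib_left distrib_right monomial_simps)

lemma Xdelta_Y_left: "Xdelta * (Y * z) = Y * (Xdelta * z)"
  by (simp add: Xdelta_Y flip: mult.assoc)

lemma S_Y: "S n * Y = (Y * S n :: 'k::finite qtorus)"
proof (induction n rule: S.induct)
  case (3 n)
  have "S (Suc n) * (Xdelta * Y) = (Y :: 'k qtorus) * (S (Suc n) * Xdelta)"
    unfolding Xdelta_Y using 3(1) by (simp flip: mult.assoc)
  moreover have "S n * Y = (Y * S n :: 'k qtorus)" by (rule 3)
  ultimately show ?case
    by (simp add: left_diff_distrib right_diff_distrib mult.assoc)
qed (simp_all add: Xdelta_Y)

lemma S_Xdelta: "S n * Xdelta = (Xdelta * S n :: 'k::finite qtorus)"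
proof (induction n rule: S.induct)
  case (3 n)
  have "S (Suc n) * (Xdelta * Xdelta) = (Xdelta :: 'k qtorus) * (S (Suc n) * Xdelta)"
    by (subst mult.assoc[symmetric], subst 3(1), rule mult.assoc)
  moreover have "S n * Xdelta = (Xdelta * S n :: 'k qtorus)" by (rule 3)
  ultimately show ?case
    by (simp add: left_diff_distrib right_diff_distrib mult.assoc Xdelta_Y_left)
qed simp_all

lemma S_Suc_Suc: "S (Suc (Suc n)) = Xdelta * S (Suc n) - Y * S n"
  by (simp add: S_Xdelta)

text \<open>Solutions that vanish at \<open>0\<close> are right multiples of the Chebyshev sequence: in this sense
  \<open>S (-1) = 0\<close>.\<close>

lemma S_unique:
  assumes "w 0 = 0" and "\<And>k. w (Suc (Suc k)) = Xdelta * w (Suc k) - Y * w k"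
  shows "w (Suc k) = S k * w 1"
proof (induction k rule: induct_nat_012)
  case 1
  show ?case using assms by simp
next
  case (ge2 k)
  then show ?case
    using assms(2) by (simp add: S_Suc_Suc del: S.simps(3)) (simp add: algebra_simps)
qed simp_all

section \<open>Solutions of the recurrence\<close>

text \<open>A sequence of two-sided solutions of the recurrence in which \<open>Y\<close> commutes with the terms up to
  the factor \<open>q\<^sup>c\<^sup>/\<^sup>2\<close>. The conditions on \<open>t 0\<close> and \<open>t 1\<close> are what makes the recurrence hold with \<open>Xdelta\<close>
  and \<open>Y\<close> on the right as well; being identities between monomials for the two rays of cluster
  variables, they are checked by calculation.\<close>

locale cluster_ray =
  fixes t :: "nat \<Rightarrow> 'k::{field,finite} qtorus" and c :: int
  assumes rec: "t (Suc (Suc k)) = Xdelta * t (Suc k) - Y * t k"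
    and t0_Y: "t 0 * Y = qh c * (Y * t 0)"
    and t1_Y: "t (Suc 0) * Y = qh c * (Y * t (Suc 0))"
    and t0_Xdelta: "t 0 * Xdelta = qh c * (Xdelta * t 0) - qh c * t (Suc 0) + t (Suc 0)"
    and t1_Xdelta: "t (Suc 0) * Xdelta = Xdelta * t (Suc 0) + qh c * (Y * t 0) - Y * t 0"
    and t1_t0: "t (Suc 0) * t 0 = t 0 * t (Suc 0)"
begin

lemma t_Y: "t k * Y = qh c * (Y * t k)"
proof (induction k rule: induct_nat_012)
  case (ge2 k)
  have "t (Suc (Suc k)) * Y = Xdelta * (t (Suc k) * Y) - Y * (t k * Y)"
    by (simp add: rec algebra_simps)
  also have "\<dots> = qh c * (Y * t (Suc (Suc k)))"
    unfolding ge2 rec by (simp add: right_diff_distrib qh_left_commute Xdelta_Y_left)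
  finally show ?case .
qed (fact t0_Y t1_Y)+

lemma t_Xdelta: "t (Suc k) * Xdelta = Xdelta * t (Suc k) + qh c * (Y * t k) - Y * t k"
proof (induction k rule: induct_nat_012)
  case 1
  have "t (Suc (Suc 0)) * Xdelta = Xdelta * (t (Suc 0) * Xdelta) - Y * (t 0 * Xdelta)"
    by (simp add: rec algebra_simps)
  also have "\<dots> = Xdelta * t (Suc (Suc 0)) + qh c * (Y * t (Suc 0)) - Y * t (Suc 0)"
    unfolding t0_Xdelta t1_Xdelta rec[of 0]
    by (simp add: right_diff_distrib distrib_left qh_left_commute Xdelta_Y_left)
  finally show ?case .
next
  case (ge2 k)
  have "t (Suc (Suc (Suc k))) * Xdelta = Xdelta * (t (Suc (Suc k)) * Xdelta) - Y * (t (Suc k) * Xdelta)"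
    unfolding rec[of "Suc k"] by (simp add: algebra_simps)
  also have "\<dots> = Xdelta * t (Suc (Suc (Suc k))) + qh c * (Y * t (Suc (Suc k))) - Y * t (Suc (Suc k))"
    unfolding ge2 rec[of "Suc k"] unfolding rec[of k]
    by (simp add: right_diff_distrib distrib_left qh_left_commute Xdelta_Y_left)
  finally show ?case .
qed (fact t1_Xdelta)

lemma rec_right: "t (Suc (Suc k)) = t (Suc k) * Xdelta - t k * Y"
  unfolding rec t_Xdelta t_Y by simp

lemma t_commute: "t (Suc k) * t k = t k * t (Suc k)"
proof (induction k)
  case (Suc k)
  have "t (Suc k) * t (Suc (Suc k)) = (t (Suc k) * Xdelta) * t (Suc k) - (t (Suc k) * Y) * t k"
    by (simp add: rec algebra_simps)
  also have "\<dots> = Xdelta * t (Suc k) * t (Suc k) + qh c * Y * (t k * t (Suc k)) - Y * t k * t (Suc k)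
      - qh c * Y * (t (Suc k) * t k)"
    unfolding t_Xdelta t_Y by (simp add: algebra_simps)
  also have "\<dots> = t (Suc (Suc k)) * t (Suc k)"
    unfolding Suc.IH by (simp add: rec algebra_simps)
  finally show ?case ..
qed (fact t1_t0)

text \<open>The exchange relations, with the two orders of the factors. Shifting the index interchanges
  them, up to the factor \<open>Y\<close>; this is why both have to be carried along.\<close>

definition W :: "nat \<Rightarrow> 'k qtorus" where
  "W k = t (Suc (Suc k)) * t k - t (Suc k) * t (Suc k)"

definition W' :: "nat \<Rightarrow> 'k qtorus" where
  "W' k = t k * t (Suc (Suc k)) - t (Suc k) * t (Suc k)"

lemma W_Suc: "W (Suc k) = Y * W' k"
proof -
  have "W (Suc k) = (Xdelta * t (Suc (Suc k)) - Y * t (Suc k)) * t (Suc k)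
      - (Xdelta * t (Suc k) - Y * t k) * t (Suc (Suc k))"
    unfolding W_def by (simp only: rec[of "Suc k"] rec[of k, symmetric])
  also have "\<dots> = Xdelta * (t (Suc (Suc k)) * t (Suc k)) - Xdelta * (t (Suc k) * t (Suc (Suc k))) + Y * W' k"
    by (simp add: W'_def algebra_simps)
  finally show ?thesis by (simp add: t_commute[of "Suc k"])
qed

lemma W'_Suc: "W' (Suc k) = W k * Y"
proof -
  have "W' (Suc k) = t (Suc k) * (t (Suc (Suc k)) * Xdelta - t (Suc k) * Y)
      - t (Suc (Suc k)) * (t (Suc k) * Xdelta - t k * Y)"
    unfolding W'_def by (simp only: rec_right[of "Suc k"] rec_right[of k, symmetric])
  also have "\<dots> = (t (Suc k) * t (Suc (Suc k))) * Xdelta - (t (Suc (Suc k)) * t (Suc k)) * Xdelta + W k * Y"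
    by (simp add: W_def algebra_simps)
  finally show ?thesis by (simp add: t_commute[of "Suc k"])
qed

text \<open>For fixed \<open>k\<close> the left-hand side solves the recurrence in \<open>n\<close>, and for \<open>n = -1\<close> it is the commutator of
  \<open>t k\<close> and \<open>t (k + 1)\<close>.\<close>

lemma product_difference:
  "t (Suc (Suc (k + n))) * t k - t (Suc (k + n)) * t (Suc k) = S n * W k"
proof -
  define w where "w j = t (Suc (k + j)) * t k - t (k + j) * t (Suc k)" for j
  have "w (Suc (Suc j)) = Xdelta * w (Suc j) - Y * w j" for j
    unfolding w_def add_Suc_right rec[of "Suc (k + j)"] rec[of "k + j"] by (simp add: algebra_simps)
  moreover have "w 0 = 0"
    by (simp add: w_def t_commute)
  ultimately have "w (Suc n) = S n * w 1"
    by (intro S_unique)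
  then show ?thesis by (simp add: w_def W_def)
qed

end

section \<open>The multiplication formulas\<close>

theorem theorem3p8:
  fixes V :: "int \<Rightarrow> 'k::{field,finite} kmod"
  assumes preproj: "\<And>l::nat. indecomposable (V (- int l)) \<and> preprojective (V (- int l)) \<and>
      dimvec (V (- int l)) = (l, l + 1)"
    and preinj: "\<And>l::nat. indecomposable (V (int l + 3)) \<and> preinjective (V (int l + 3)) \<and>
      dimvec (V (int l + 3)) = (l + 1, l)"
  shows "(\<forall>l. cvar V l \<in> Aq V) \<and> (\<forall>n. S n \<in> Aq V) \<and>
    (\<forall>m n :: nat.
      cvar V (- (int m + int n + 2)) * cvar V (- int m) =
        qh (-1) * S n * X (0, 0, int m, int m + 1)
        + cvar V (- (int n + int m + 1)) * cvar V (- (int m + 1))) \<and>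
    (\<forall>m n :: nat. m \<ge> 1 \<longrightarrow>
      cvar V (int m + int n + 2) * cvar V (int m) =
        qh 1 * S n * X (0, 0, int m, int m - 1)
        + cvar V (int n + int m + 1) * cvar V (int m + 1)) \<and>
    (\<forall>n :: nat.
      cvar V 0 * cvar V (int n + 2) = qh (2 * int n + 1) * cvar V 1 * cvar V (int n + 1) * y2 + S n) \<and>
    (\<forall>m :: nat. m \<ge> 1 \<longrightarrow>
      cvar V (- int m) * cvar V 1 = S (m - 1) + qh 1 * cvar V (- (int m - 1)) * cvar V 0 * y1) \<and>
    (\<forall>m n :: nat. m \<ge> 1 \<longrightarrow> n \<ge> 2 \<longrightarrow>
      cvar V (- int m) * cvar V (int n) =
        qh 2 * cvar V (- (int m - 1)) * cvar V (int n - 1) * X (0, 0, 1, 1) + S (m + n - 2))"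
proof -
  let ?q = "real CARD('k)"
  have q: "?q > 1" using field_order_gt_1[where 'k = 'k] by simp

  \<comment> \<open>The two rays of cluster variables. The first one is prolonged by two monomials so that both
      start with monomials.\<close>
  define p :: "nat \<Rightarrow> 'k qtorus" where
    "p k = (if k = 0 then X (0, 1, -2, -1) else if k = 1 then X (1, 0, -1, 0) else XM (V (- (int k - 2))))" for k
  define z :: "nat \<Rightarrow> 'k qtorus" where "z k = cvar V (int k + 1)" for k
  have p0: "p 0 = X (0, 1, -2, -1)" and p1: "p (Suc 0) = X (1, 0, -1, 0)"
    by (simp_all add: p_def)
  have z0: "z 0 = X (1, 0, 0, 0)" and z1: "z (Suc 0) = X (0, 1, 0, 0)"
    by (simp_all add: z_def cvar_def)
  have p_cvar: "cvar V (- int m) = p (Suc (Suc m))" for m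
    by (simp add: p_def cvar_def)

  have p_exp: "has_expansion (p k) (int k - 2) (int k - 1) (preproj_weight ?q (int k - 2))" for k
  proof -
    consider "k = 0" | "k = 1" | l where "k = Suc (Suc l)"
      by (metis One_nat_def not0_implies_Suc)
    then show ?thesis
    proof cases
      case 1
      have "preproj_weight ?q (- 2) a b = (if a = 0 \<and> b = 0 then 1 else 0)" for a b
        by (auto simp: preproj_weight_def gauss_binom_int_def)
      from has_expansion_X[where ?m1.0 = "-2" and ?m2.0 = "-1", OF this] show ?thesis
        using 1 by (simp add: p0)
    next
      case 2
      have "preproj_weight ?q (- 1) a b = (if a = 0 \<and> b = 0 then 1 else 0)" for a b
        by (auto simp: preproj_weight_def gauss_binom_int_def)
      from has_expansion_X[where ?m1.0 = "-1" and ?m2.0 = "0", OF this] show ?thesis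
        using 2 by (simp add: p1)
    next
      case 3
      then show ?thesis
        using preproj_expansion[of "V (- int l)" l] preproj[of l] by (simp add: p_def add.commute)
    qed
  qed
  have z_exp: "has_expansion (z k) (int k - 1) (int k - 2) (preinj_weight ?q (int k - 2))" for k
  proof -
    consider "k = 0" | "k = 1" | l where "k = Suc (Suc l)"
      by (metis One_nat_def not0_implies_Suc)
    then show ?thesis
    proof cases
      case 1
      have "preinj_weight ?q (- 2) a b = (if a = -1 \<and> b = -2 then 1 else 0)" for a b
        by (auto simp: preinj_weight_def gauss_binom_int_def)
      from has_expansion_X[where ?m1.0 = "-1" and ?m2.0 = "-2", OF this] show ?thesis
        using 1 by (simp add: z0)
    next
      case 2
      have "preinj_weight ?q (- 1) a b = (if a = 0 \<and> b = -1 then 1 else 0)" for a b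
        by (auto simp: preinj_weight_def gauss_binom_int_def)
      from has_expansion_X[where ?m1.0 = "0" and ?m2.0 = "-1", OF this] show ?thesis
        using 2 by (simp add: z1)
    next
      case 3
      then show ?thesis
        using preinj_expansion[of "V (int l + 3)" l] preinj[of l] by (simp add: z_def cvar_def add.commute)
    qed
  qed
  have p_rec: "p (Suc (Suc k)) = Xdelta * p (Suc k) - Y * p k" for k
  proof (rule has_expansion_recurrence)
    show "has_expansion (p k) (int k - 1 - 1) (int k - 1) (preproj_weight ?q (int k - 2))"
      using p_exp[of k] by simp
    show "has_expansion (p (Suc k)) (int k - 1) (int k) (preproj_weight ?q (int k - 1))"
      using p_exp[of "Suc k"] by simp
    show "has_expansion (p (Suc (Suc k))) (int k - 1 + 1) (int k + 1) (preproj_weight ?q (int k))"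
      using p_exp[of "Suc (Suc k)"] by (simp add: add.commute)
    show "preproj_weight ?q (int k) a b + ?q powi (b - a + (int k - 1 - int k)) * preproj_weight ?q (int k - 2) (a - 1) (b - 1) =
      preproj_weight ?q (int k - 1) a b + ?q powi (int k + 1 - b) * preproj_weight ?q (int k - 1) a (b - 1)
        + ?q powi (b - a + (int k - 1 - int k)) * preproj_weight ?q (int k - 1) (a - 1) (b - 1)" for a b
      using preproj_weight_recurrence[OF q, of "int k - 1" a b] by (simp add: algebra_simps)
  qed
  have z_rec: "z (Suc (Suc k)) = Xdelta * z (Suc k) - Y * z k" for k
  proof (rule has_expansion_recurrence)
    show "has_expansion (z k) (int k - 1) (int k - 1 - 1) (preinj_weight ?q (int k - 2))"
      using z_exp[of k] by simp
    show "has_expansion (z (Suc k)) (int k) (int k - 1) (preinj_weight ?q (int k - 1))"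
      using z_exp[of "Suc k"] by simp
    show "has_expansion (z (Suc (Suc k))) (int k + 1) (int k - 1 + 1) (preinj_weight ?q (int k))"
      using z_exp[of "Suc (Suc k)"] by (simp add: add.commute)
    show "preinj_weight ?q (int k) a b + ?q powi (b - a + (int k - (int k - 1))) * preinj_weight ?q (int k - 2) (a - 1) (b - 1) =
      preinj_weight ?q (int k - 1) a b + ?q powi (int k - 1 + 1 - b) * preinj_weight ?q (int k - 1) a (b - 1)
        + ?q powi (b - a + (int k - (int k - 1))) * preinj_weight ?q (int k - 1) (a - 1) (b - 1)" for a b
      using preinj_weight_recurrence[OF q, of "int k - 1" a b] by (simp add: algebra_simps)
  qed

  interpret p: cluster_ray p 2
    by unfold_locales
       (simp_all add: p_rec p0 p1 Xdelta_def distrib_left distrib_right monomial_simps)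
  interpret z: cluster_ray z "-2"
    by unfold_locales
       (simp_all add: z_rec z0 z1 Xdelta_def distrib_left distrib_right monomial_simps)

  have p2: "p (Suc (Suc 0)) = X (2, -1, 0, 1) + X (0, -1, 0, 0)"
    by (simp add: p_rec p0 p1 Xdelta_def distrib_right monomial_simps)
  have z2: "z (Suc (Suc 0)) = X (-1, 0, 1, 0) + X (-1, 2, 0, 0)"
    by (simp add: z_rec z0 z1 Xdelta_def distrib_right monomial_simps)
  have p_W: "p.W k = qh (-1) * X (0, 0, int k - 2, int k - 1) \<and>
      p.W' k = qh 1 * X (0, 0, int k - 2, int k - 1)" for k
  proof (induction k)
    case 0
    show ?case
      by (simp add: p.W_def p.W'_def p2 p0 p1 distrib_left distrib_right monomial_simps)
  next
    case (Suc k)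
    then show ?case
      by (simp add: p.W_Suc p.W'_Suc mult.assoc monomial_simps)
  qed
  have z_W: "z.W k = qh 1 * X (0, 0, int k + 1, int k) \<and>
      z.W' k = qh (-1) * X (0, 0, int k + 1, int k)" for k
  proof (induction k)
    case 0
    show ?case
      by (simp add: z.W_def z.W'_def z2 z0 z1 distrib_left distrib_right monomial_simps)
  next
    case (Suc k)
    then show ?case
      by (simp add: z.W_Suc z.W'_Suc mult.assoc monomial_simps add.commute)
  qed

  \<comment> \<open>The third and the fifth identity are both \<open>w m n = S (m + n - 1)\<close>, where
      \<open>\<sigma>\<close> is the Chebyshev sequence shifted by one. The left factor gives the recurrence in \<open>m\<close>, the right one
      the recurrence in \<open>n\<close>.\<close>
  define w where "w m n = p (Suc m) * z (Suc n) - p m * (Y * z n)" for m n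
  define \<sigma> :: "nat \<Rightarrow> 'k qtorus" where "\<sigma> k = (case k of 0 \<Rightarrow> 0 | Suc j \<Rightarrow> S j)" for k
  have \<sigma>_rec: "\<sigma> (Suc (Suc k)) = Xdelta * \<sigma> (Suc k) - Y * \<sigma> k"
    "\<sigma> (Suc (Suc k)) = \<sigma> (Suc k) * Xdelta - \<sigma> k * Y" for k
    by (cases k; simp add: \<sigma>_def S_Xdelta S_Y)+
  have w_left: "w (Suc (Suc m)) n = Xdelta * w (Suc m) n - Y * w m n" for m n
    by (simp add: w_def p_rec[of "Suc m"] p_rec[of m] algebra_simps)
  have w_right: "w m (Suc (Suc n)) = w m (Suc n) * Xdelta - w m n * Y" for m n
    unfolding w_def z.rec_right[of "Suc n"] z.rec_right[of n] by (simp add: algebra_simps)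
  have w_base: "w 0 0 = 0" "w (Suc 0) 0 = 1" "w 0 (Suc 0) = 1" "w (Suc 0) (Suc 0) = Xdelta"
    by (simp_all add: w_def p0 p1 p2 z0 z1 z2 Xdelta_def distrib_left distrib_right monomial_simps)
  have w0: "w m 0 = \<sigma> m" for m
    by (induction m rule: induct_nat_012) (simp_all add: w_base w_left \<sigma>_rec(1), simp_all add: \<sigma>_def)
  have w1: "w m (Suc 0) = \<sigma> (Suc m)" for m
    by (induction m rule: induct_nat_012) (simp_all add: w_base w_left \<sigma>_rec(1), simp_all add: \<sigma>_def)
  have w: "w m n = \<sigma> (m + n)" for m n
    by (induction n rule: induct_nat_012) (simp_all add: w0 w1 w_right \<sigma>_rec(2))

  \<comment> \<open>In the third identity \<open>y2\<close> stands on the right of \<open>z n\<close> instead of the left.\<close>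
  have y2_Xdelta: "y2 * (Xdelta * x) = qh 2 * (Xdelta * (y2 * x))" for x :: "'k qtorus"
    by (simp add: Xdelta_def distrib_left distrib_right monomial_simps mult.assoc)
  have y2_z: "y2 * z n = qh (2 * int n) * (z n * y2)" for n
  proof (induction n rule: induct_nat_012)
    case (ge2 n)
    have "y2 * z (Suc (Suc n)) = qh 2 * (Xdelta * (y2 * z (Suc n))) - qh 4 * (Y * (y2 * z n))"
      unfolding z_rec right_diff_distrib y2_Xdelta by (simp add: monomial_simps)
    also have "\<dots> = qh (2 * int (Suc (Suc n))) * (z (Suc (Suc n)) * y2)"
      unfolding ge2 z_rec by (simp add: qh_left_commute[of Xdelta] qh_left_commute[of Y] qh_mult_left algebra_simps)
    finally show ?case .
  qed (simp_all add: z0 z1 monomial_simps)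

  have part3: "cvar V 0 * cvar V (int n + 2) = qh (2 * int n + 1) * cvar V 1 * cvar V (int n + 1) * y2 + S n" for n
  proof -
    have "p (Suc 0) * (Y * z n) = qh 1 * z 0 * (y2 * z n)"
      by (simp add: p1 z0 monomial_simps mult.assoc)
    also have "\<dots> = qh (2 * int n + 1) * z 0 * z n * y2"
      unfolding y2_z by (simp add: qh_left_commute[of "z 0"] qh_mult_left mult.assoc add.commute)
    finally have "p (Suc (Suc 0)) * z (Suc n) = qh (2 * int n + 1) * z 0 * z n * y2 + S n"
      using w[of "Suc 0" n] by (simp add: w_def \<sigma>_def algebra_simps)
    then show ?thesis
      using p_cvar[of 0] by (simp add: z_def add.commute)
  qed

  have part1: "cvar V (- (int m + int n + 2)) * cvar V (- int m) =
        qh (-1) * S n * X (0, 0, int m, int m + 1)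
        + cvar V (- (int n + int m + 1)) * cvar V (- (int m + 1))" for m n
  proof -
    have "p (Suc (Suc (Suc (Suc (m + n))))) * p (Suc (Suc m)) - p (Suc (Suc (Suc (m + n)))) * p (Suc (Suc (Suc m)))
      = S n * (qh (-1) * X (0, 0, int m, int m + 1))"
      using p.product_difference[of "Suc (Suc m)" n] p_W[of "Suc (Suc m)"] by (simp add: add.commute)
    moreover have "cvar V (- (int m + int n + 2)) = p (Suc (Suc (Suc (Suc (m + n)))))"
      "cvar V (- (int n + int m + 1)) = p (Suc (Suc (Suc (m + n))))"
      "cvar V (- (int m + 1)) = p (Suc (Suc (Suc m)))"
      using p_cvar[of "m + n + 2"] p_cvar[of "m + n + 1"] p_cvar[of "m + 1"]
      by (simp_all add: algebra_simps)
    ultimately show ?thesis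
      by (simp add: p_cvar qh_left_commute[of "S n"] mult.assoc algebra_simps)
  qed

  have part2: "cvar V (int m + int n + 2) * cvar V (int m) =
        qh 1 * S n * X (0, 0, int m, int m - 1)
        + cvar V (int n + int m + 1) * cvar V (int m + 1)" if "m \<ge> 1" for m n
  proof -
    obtain k where m: "m = Suc k" using \<open>m \<ge> 1\<close> by (cases m) auto
    have "z (Suc (Suc (k + n))) * z k - z (Suc (k + n)) * z (Suc k) = S n * (qh 1 * X (0, 0, int k + 1, int k))"
      using z.product_difference[of k n] z_W[of k] by simp
    then show ?thesis
      by (simp add: m z_def qh_left_commute[of "S n"] mult.assoc algebra_simps)
  qed

  have part4: "cvar V (- int m) * cvar V 1 = S (m - 1) + qh 1 * cvar V (- (int m - 1)) * cvar V 0 * y1"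
    if "m \<ge> 1" for m
  proof -
    obtain k where m: "m = Suc k" using \<open>m \<ge> 1\<close> by (cases m) auto
    \<comment> \<open>Here the right factors are fixed, so that the recurrence of \<open>p\<close> carries over.\<close>
    define v where "v j = p (Suc (Suc j)) * z 0 - qh 1 * (p (Suc j) * (p (Suc (Suc 0)) * y1))" for j
    have "v (Suc (Suc j)) = Xdelta * v (Suc j) - Y * v j" for j
      by (simp add: v_def p_rec[of "Suc (Suc j)"] p_rec[of "Suc j"]
        qh_left_commute[of Xdelta] qh_left_commute[of Y] algebra_simps)
    moreover have "v 0 = 0"
      by (simp add: v_def p1 p2 z0 distrib_left distrib_right monomial_simps)
    ultimately have "v (Suc k) = S k * v 1"
      by (intro S_unique)
    moreover have "v 1 = 1"
      unfolding v_def One_nat_def p_rec[of "Suc 0"]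
      by (simp add: p1 p2 z0 Xdelta_def distrib_left distrib_right left_diff_distrib right_diff_distrib mult.assoc monomial_simps)
    ultimately have "p (Suc (Suc (Suc k))) * z 0 = S k + qh 1 * (p (Suc (Suc k)) * (p (Suc (Suc 0)) * y1))"
      by (simp add: v_def algebra_simps)
    then show ?thesis
      using p_cvar[of "Suc k"] p_cvar[of k] p_cvar[of 0] by (simp add: m z_def mult.assoc)
  qed

  have part5: "cvar V (- int m) * cvar V (int n) =
        qh 2 * cvar V (- (int m - 1)) * cvar V (int n - 1) * X (0, 0, 1, 1) + S (m + n - 2)"
    if "m \<ge> 1" "n \<ge> 2" for m n
  proof -
    obtain k where m: "m = Suc k" using \<open>m \<ge> 1\<close> by (cases m) auto
    obtain j where n: "n = Suc (Suc j)" using \<open>n \<ge> 2\<close> by (metis One_nat_def Suc_1 Suc_le_D Suc_le_mono)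
    have "qh 2 * p (Suc (Suc k)) * z j * Y = p (Suc (Suc k)) * (Y * z j)"
      by (simp add: mult.assoc z.t_Y qh_left_commute[of "p (Suc (Suc k))"] qh_mult_left qh_0)
    moreover have "p (Suc (Suc (Suc k))) * z (Suc j) - p (Suc (Suc k)) * (Y * z j) = S (Suc k + j)"
      using w[of "Suc (Suc k)" j] by (simp add: w_def \<sigma>_def)
    ultimately have "p (Suc (Suc (Suc k))) * z (Suc j) = qh 2 * p (Suc (Suc k)) * z j * Y + S (Suc k + j)"
      by (simp add: algebra_simps)
    then show ?thesis
      using p_cvar[of "Suc k"] p_cvar[of k] by (simp add: m n z_def add.commute)
  qed

  have cvar_Aq: "cvar V l \<in> Aq V" for l
    unfolding Aq_def by (rule subring_gen.gen) simp
  have qh_Aq: "qh (int n) \<in> Aq V" for n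
  proof (induction n)
    case 0
    show ?case unfolding Aq_def by (simp add: qh_0 subring_gen.one)
  next
    case (Suc n)
    have "qh 1 \<in> Aq V" unfolding Aq_def by (rule subring_gen.gen) simp
    then have "qh 1 * qh (int n) \<in> Aq V"
      using Suc unfolding Aq_def by (rule subring_gen.mult)
    then show ?case by (simp add: qh_mult add.commute)
  qed
  \<comment> \<open>By the third identity \<open>S n\<close> is a polynomial in cluster variables and coefficients.\<close>
  have S_Aq: "S n \<in> Aq V" for n
  proof -
    have "y2 \<in> Aq V" unfolding Aq_def by (rule subring_gen.gen) simp
    moreover have "S n = cvar V 0 * cvar V (int n + 2)
        - qh (int (2 * n + 1)) * cvar V 1 * cvar V (int n + 1) * y2"
      using part3[of n] by (simp add: algebra_simps)
    ultimately show ?thesis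
      using cvar_Aq qh_Aq[of "2 * n + 1"] unfolding Aq_def
      by (metis subring_gen.diff subring_gen.mult)
  qed
  show ?thesis
    using cvar_Aq S_Aq part1 part2 part3 part4 part5 by blast
qed

end
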